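(* Let $d\ge2$ and let $f(z)=\sum_{j=0}^d a_j\binom{z+d-j}{d}$ be a polynomial of degree $d$ with $a_j\ge0$ for all $j$. Then all non-real roots of $f$ are contained in the closed region $\mathrm{cl}\,\mathcal{D}_{0,d;1}$ bounded by the outermost oval of the real algebraic curve $$\frac{\binom{z}{d}\overline{\binom{z+d}{d}}-\overline{\binom{z}{d}}\binom{z+d}{d}}{z-\bar z}=0$$ (equivalently, of the curve $D_{0,d}(x,y)=0$, $z=x+iy$), and every point of $\mathrm{cl}\,\mathcal{D}_{0,d;1}$ is a root of some such $f$. The real roots of $f$ all lie in the real interval $[-d,d-1]$.
   Context: $\bar\cdot$ denotes complex conjugation. For $0\le m\le d-2$ set $p_m=(x-m)^2+y^2$, $r_m=(x-m-1+d)^2+y^2$, $q_m=p_m+r_m-d(d-1)$; $D_{0,d}(x,y)$ is the determinant of the $(d-1)\times(d-1)$ tridiagonal matrix with diagonal entries $-q_0,\dots,-q_{d-2}$, superdiagonal entries $p_1,\dots,p_{d-2}$ and subdiagonal entries $r_0,\dots,r_{d-3}$; it is a nonzero constant multiple of the displayed expression. Its zero set in $\mathbb{R}^2\cong\mathbb{C}$ consists of $d-1$ nested ovals, and $\mathrm{cl}\,\mathcal{D}_{0,d;1}$ denotes the closed region bounded by the outermost one. *)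

theory Defs
  imports
    "HOL-Analysis.Analysis"
    "HOL-Computational_Algebra.Polynomial"
    "Jordan_Normal_Form.Determinant"
begin

text \<open>Here \<open>z gchoose d\<close> is the polynomial \<open>z (z - 1) \<cdots> (z - d + 1) / d!\<close>, and the shift
  \<open>of_nat d - of_nat j\<close> is taken in the complex numbers.\<close>

definition nonneg_binomial_poly :: "nat \<Rightarrow> complex poly \<Rightarrow> bool" where
  "nonneg_binomial_poly d f \<longleftrightarrow>
     degree f = d \<and>
     (\<exists>a :: nat \<Rightarrow> real. (\<forall>j\<le>d. 0 \<le> a j) \<and>
        (\<forall>z. poly f z =
           (\<Sum>j=0..d. complex_of_real (a j) * ((z + of_nat d - of_nat j) gchoose d))))"

definition curve_quotient :: "nat \<Rightarrow> complex \<Rightarrow> complex" where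
  "curve_quotient d z =
     ((z gchoose d) * cnj ((z + of_nat d) gchoose d)
        - cnj (z gchoose d) * ((z + of_nat d) gchoose d)) / (z - cnj z)"

text \<open>The numerator of the quotient is divisible by \<open>z - cnj z\<close> as a polynomial in \<open>Re z\<close> and
  \<open>Im z\<close>, and the curve is the zero set of the resulting polynomial. On the real axis, where the
  pointwise quotient would be \<open>0 / 0\<close>, the value of that polynomial is the limit of the quotient
  from non-real points.\<close>

definition curve_poly :: "nat \<Rightarrow> complex \<Rightarrow> complex" where
  "curve_poly d z =
     (if z \<in> \<real> then Lim (at z within - \<real>) (curve_quotient d) else curve_quotient d z)"

definition curve :: "nat \<Rightarrow> complex set" where
  "curve d = {z. curve_poly d z = 0}"

definition p_entry :: "nat \<Rightarrow> real \<Rightarrow> real \<Rightarrow> real" where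
  "p_entry m x y = (x - real m)\<^sup>2 + y\<^sup>2"

definition r_entry :: "nat \<Rightarrow> nat \<Rightarrow> real \<Rightarrow> real \<Rightarrow> real" where
  "r_entry d m x y = (x - real m - 1 + real d)\<^sup>2 + y\<^sup>2"

definition q_entry :: "nat \<Rightarrow> nat \<Rightarrow> real \<Rightarrow> real \<Rightarrow> real" where
  "q_entry d m x y = p_entry m x y + r_entry d m x y - real d * (real d - 1)"

definition D0 :: "nat \<Rightarrow> real \<Rightarrow> real \<Rightarrow> real" where
  "D0 d x y = Determinant.det (mat (d - 1) (d - 1) (\<lambda>(i, j).
     if i = j then - q_entry d i x y
     else if j = i + 1 then p_entry j x y
     else if i = j + 1 then r_entry d j x y
     else 0))"

text \<open>An oval is a connected component that is a Jordan curve; the outermost one has all the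
  others in its interior. The \<open>inside\<close> of a set is the union of the bounded
  components of its complement.\<close>

definition is_oval :: "nat \<Rightarrow> complex set \<Rightarrow> bool" where
  "is_oval d C \<longleftrightarrow> C \<in> components (curve d) \<and> C homeomorphic sphere (0 :: complex) 1"

definition outermost_oval :: "nat \<Rightarrow> complex set" where
  "outermost_oval d =
     (THE C. is_oval d C \<and> (\<forall>C'. is_oval d C' \<and> C' \<noteq> C \<longrightarrow> C' \<subseteq> inside C))"

definition cl_region :: "nat \<Rightarrow> complex set" where
  "cl_region d = outermost_oval d \<union> inside (outermost_oval d)"

end

theory Submission
  imports Defs "HOL-Real_Asymp.Real_Asymp"
begin

text \<open>
  Put \<open>w = z + 1/2\<close>, \<open>c\<^sub>j = j + 1/2\<close> and \<open>V\<^sub>k(z) = (z+d-k)(z+d-k-1)\<cdots>(z-k+1) = d! \<cdot> binom(z+d-k, d)\<close>. Then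
  \<open>V\<^sub>d \<cdot> cnj V\<^sub>0\<close> is the product of the numbers \<open>(w - c\<^sub>j) \<cdot> cnj (w + c\<^sub>j)\<close>, so for \<open>Im z > 0\<close> its argument
  is the sum \<open>\<Theta>(w)\<close> of the angles under which the concentric segments \<open>[-c\<^sub>j, c\<^sub>j]\<close> are seen from \<open>w\<close>.
  The curve is the set where \<open>\<Theta>\<close> is a multiple of \<open>\<pi>\<close>. Since \<open>\<Theta>\<close> decreases along every ray from
  \<open>w = 0\<close>, the level set \<open>\<Theta> = \<pi>\<close> meets every such ray exactly once; it is the outermost oval, and the
  region it bounds is \<open>\<Theta> \<ge> \<pi>\<close>. On the other hand the arguments of \<open>V\<^sub>0, \<dots>, V\<^sub>d\<close> increase in steps
  smaller than \<open>\<pi>\<close> by \<open>\<Theta>\<close> in total, so \<open>0\<close> is a nontrivial nonnegative combination of the \<open>V\<^sub>k\<close>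
  if and only if \<open>\<Theta> \<ge> \<pi>\<close>. The determinant enters through the real relation
  \<open>p\<^sub>m V\<^sub>m - q\<^sub>m V\<^bsub>m+1\<^esub> + r\<^sub>m V\<^bsub>m+2\<^esub> = 0\<close>, which makes \<open>Im (cnj V\<^sub>0 \<cdot> V\<^sub>k)\<close> satisfy the recurrence of the
  continuants of the tridiagonal matrix.
\<close>

section \<open>Tridiagonal determinants\<close>

text \<open>Laplace expansion along the last row leaves two minors. The one belonging to the
  subdiagonal entry \<open>c n\<close> has a single nonzero entry \<open>b (Suc n)\<close> in its
  last column, and expanding along that column gives \<open>T n\<close>.\<close>

lemma det_tridiagonal:
  fixes a b c :: "nat \<Rightarrow> 'a :: comm_ring_1"
  defines "T \<equiv> \<lambda>n. Determinant.det (mat n n (\<lambda>(i, j).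
     if i = j then a i else if j = i + 1 then b j else if i = j + 1 then c j else 0))"
  shows "T 0 = 1" and "T (Suc 0) = a 0"
    and "T (Suc (Suc n)) = a (Suc n) * T (Suc n) - b (Suc n) * c n * T n"
proof -
  define F where "F = (\<lambda>(i, j). if i = j then a i else if j = i + 1 then b j
     else if i = j + 1 then c j else (0::'a))"
  have T: "T n = Determinant.det (mat n n F)" for n
    by (simp add: T_def F_def)
  show "T 0 = 1" by (simp add: T det_dim_zero)
  show "T (Suc 0) = a 0"
    by (simp add: T Determinant.det_single F_def)
  define A where "A = mat (Suc (Suc n)) (Suc (Suc n)) F"
  have A: "A \<in> carrier_mat (Suc (Suc n)) (Suc (Suc n))" by (simp add: A_def)
  define B where "B = mat_delete A (Suc n) n"
  have B: "B \<in> carrier_mat (Suc n) (Suc n)" by (simp add: B_def A_def mat_delete_def)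
  have del1: "mat_delete A (Suc n) (Suc n) = mat (Suc n) (Suc n) F"
    by (rule eq_matI) (auto simp: mat_delete_def A_def)
  have del2: "mat_delete B n n = mat n n F"
    by (rule eq_matI) (auto simp: mat_delete_def A_def B_def)
  have Bcol: "B $$ (i, n) = (if i = n then b (Suc n) else 0)" if "i < Suc n" for i
    using that by (auto simp: B_def mat_delete_def A_def F_def)
  have "Determinant.det B = (\<Sum>i<Suc n. B $$ (i, n) * cofactor B i n)"
    by (rule laplace_expansion_column[OF B]) simp
  also have "\<dots> = (\<Sum>i<Suc n. if i = n then b (Suc n) * cofactor B n n else 0)"
    by (rule sum.cong) (auto simp: Bcol)
  also have "\<dots> = b (Suc n) * T n"
    by (simp add: Determinant.cofactor_def del2 T)
  finally have detB: "Determinant.det B = b (Suc n) * T n" .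
  have "T (Suc (Suc n)) = (\<Sum>j<Suc (Suc n). A $$ (Suc n, j) * cofactor A (Suc n) j)"
    unfolding T A_def[symmetric] by (rule laplace_expansion_row[OF A]) simp
  also have "\<dots> = A $$ (Suc n, n) * cofactor A (Suc n) n
      + A $$ (Suc n, Suc n) * cofactor A (Suc n) (Suc n)"
    by (simp add: A_def F_def)
  also have "\<dots> = a (Suc n) * T (Suc n) - b (Suc n) * c n * T n"
    by (simp add: Determinant.cofactor_def del1 T[symmetric] B_def[symmetric] detB)
       (simp add: A_def F_def)
  finally show "T (Suc (Suc n)) = a (Suc n) * T (Suc n) - b (Suc n) * c n * T n" .
qed

section \<open>Closed curves that are radial graphs\<close>

text \<open>Compactness replaces a proof that the radius depends continuously on the direction:
  radial projection is a continuous bijection of \<open>C\<close> onto the unit sphere, hence a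
  homeomorphism. The complement of \<open>C\<close> splits into the points that must be stretched
  and those that must be shrunk about \<open>a\<close> to reach \<open>C\<close>.\<close>

lemma radial_curve:
  fixes C :: "'a :: euclidean_space set"
  assumes C: "compact C" and a: "a \<notin> C"
    and ray: "\<And>w. w \<noteq> 0 \<Longrightarrow> \<exists>!s. 0 < s \<and> a + s *\<^sub>R w \<in> C"
  shows radial_curve_homeomorphic: "C homeomorphic sphere (0 :: 'a) 1"
    and radial_curve_inside: "inside C = insert a {z. \<exists>s>1. a + s *\<^sub>R (z - a) \<in> C}"
proof -
  have unique: "s = t" if "0 < s" "0 < t" "a + s *\<^sub>R w \<in> C" "a + t *\<^sub>R w \<in> C" for s t w
  proof -
    have "w \<noteq> 0" using that a by auto
    then show ?thesis using ray that by blast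
  qed
  show "C homeomorphic sphere (0 :: 'a) 1"
  proof -
    have "continuous_on C (\<lambda>z. sgn (z - a))"
      using a by (intro continuous_intros) auto
    moreover have "(\<lambda>z. sgn (z - a)) ` C = sphere 0 1"
    proof (intro equalityI subsetI)
      fix u assume "u \<in> (\<lambda>z. sgn (z - a)) ` C"
      then show "u \<in> sphere 0 1" using a by (auto simp: norm_sgn)
    next
      fix u :: 'a assume u: "u \<in> sphere 0 1"
      then obtain s where s: "s > 0" "a + s *\<^sub>R u \<in> C" using ray[of u] by force
      have "sgn (a + s *\<^sub>R u - a) = u"
        using s u by (simp add: sgn_scaleR) (simp add: sgn_div_norm)
      then show "u \<in> (\<lambda>z. sgn (z - a)) ` C" using s by (metis imageI)
    qed
    moreover have "inj_on (\<lambda>z. sgn (z - a)) C"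
    proof (rule inj_onI)
      fix x y assume xy: "x \<in> C" "y \<in> C" "sgn (x - a) = sgn (y - a)"
      have eq: "a + norm (v - a) *\<^sub>R sgn (v - a) = v" for v
        by (cases "v = a") (auto simp: sgn_div_norm)
      have "norm (x - a) = norm (y - a)"
      proof (rule unique)
        show "a + norm (x - a) *\<^sub>R sgn (x - a) \<in> C" using xy eq[of x] by simp
        show "a + norm (y - a) *\<^sub>R sgn (x - a) \<in> C" using xy eq[of y] by simp
      qed (use xy a in auto)
      then show "x = y" using eq[of x] eq[of y] xy by metis
    qed
    ultimately show ?thesis
      by (metis C homeomorphic_compact)
  qed
  \<comment> \<open>\<open>I\<close> and \<open>E\<close> are the candidates for the inside and the
    outside. Their openness is obtained from closedness of \<open>E \<union> C\<close> and
    \<open>I \<union> C\<close>.\<close>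
  define I where "I = insert a {z. \<exists>s>1. a + s *\<^sub>R (z - a) \<in> C}"
  define E where "E = {z. \<exists>s. 0 < s \<and> s < 1 \<and> a + s *\<^sub>R (z - a) \<in> C}"
  obtain e :: 'a where e: "e \<noteq> 0" by (metis SOME_Basis nonzero_Basis)
  have Cne: "C \<noteq> {}" using ray[OF e] by auto
  have cover: "z \<in> C \<or> z \<in> I \<or> z \<in> E" for z
  proof (cases "z = a")
    case False
    then obtain s where s: "0 < s" "a + s *\<^sub>R (z - a) \<in> C" using ray[of "z - a"] by auto
    consider "s < 1" | "s = 1" | "s > 1" by linarith
    then show ?thesis using s by cases (auto simp: I_def E_def)
  qed (simp add: I_def)
  have IC: "I \<inter> C = {}"
  proof -
    have "False" if "z \<in> C" "s > 1" "a + s *\<^sub>R (z - a) \<in> C" for z s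
      using unique[of s 1 "z - a"] that by simp
    then show ?thesis using a by (auto simp: I_def)
  qed
  have EC: "E \<inter> C = {}"
  proof -
    have "False" if "z \<in> C" "0 < s" "s < 1" "a + s *\<^sub>R (z - a) \<in> C" for z s
      using unique[of s 1 "z - a"] that by simp
    then show ?thesis by (auto simp: E_def)
  qed
  have IE: "I \<inter> E = {}"
  proof -
    have "False" if "1 < t" "a + t *\<^sub>R (z - a) \<in> C" "0 < s" "s < 1" "a + s *\<^sub>R (z - a) \<in> C" for z s t
      using unique[of s t "z - a"] that by simp
    then show ?thesis using a by (auto simp: I_def E_def)
  qed
  have IuC: "I \<union> C = (\<lambda>(s, z). a + s *\<^sub>R (z - a)) ` ({0..1} \<times> C)" (is "_ = ?h ` _")
  proof (intro equalityI subsetI)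
    fix z assume "z \<in> I \<union> C"
    then consider "z = a" | s where "s > 1" "a + s *\<^sub>R (z - a) \<in> C" | "z \<in> C"
      by (auto simp: I_def)
    then show "z \<in> ?h ` ({0..1} \<times> C)"
    proof cases
      case 1
      then show ?thesis using Cne by (force intro!: image_eqI[where x = "(0, SOME c. c \<in> C)"] some_in_eq[THEN iffD2])
    next
      case (2 s)
      then show ?thesis
        by (intro image_eqI[where x = "(inverse s, a + s *\<^sub>R (z - a))"]) (auto simp: inverse_le_1_iff)
    next
      case 3
      then show ?thesis by (intro image_eqI[where x = "(1, z)"]) auto
    qed
  next
    fix z assume "z \<in> ?h ` ({0..1} \<times> C)"
    then obtain s c where sc: "0 \<le> s" "s \<le> 1" "c \<in> C" "z = a + s *\<^sub>R (c - a)" by auto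
    consider "s = 0" | "s = 1" | "0 < s" "s < 1" using sc by linarith
    then show "z \<in> I \<union> C"
    proof cases
      case 3
      then have "inverse s > 1" "a + inverse s *\<^sub>R (z - a) \<in> C"
        using sc by (auto simp: one_less_inverse_iff)
      then show ?thesis by (auto simp: I_def)
    qed (use sc in \<open>auto simp: I_def\<close>)
  qed
  have compIC: "compact (I \<union> C)"
    unfolding IuC by (intro compact_continuous_image compact_Times C)
      (auto simp: case_prod_unfold intro!: continuous_intros)
  \<comment> \<open>This exhibits the set as the projection of a closed set along the compact
    interval of scaling factors. The factor \<open>0\<close> adds no points because \<open>a\<close>
    is not on \<open>C\<close>.\<close>
  have "E \<union> C = {z. \<exists>s. s \<in> {0..1} \<and> (s, z) \<in> {p. a + fst p *\<^sub>R (snd p - a) \<in> C}}"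
  proof (intro equalityI subsetI)
    fix z assume "z \<in> {z. \<exists>s. s \<in> {0..1} \<and> (s, z) \<in> {p. a + fst p *\<^sub>R (snd p - a) \<in> C}}"
    then obtain s where s: "0 \<le> s" "s \<le> 1" "a + s *\<^sub>R (z - a) \<in> C" by auto
    consider "s = 0" | "s = 1" | "0 < s" "s < 1" using s by linarith
    then show "z \<in> E \<union> C" by cases (use s a in \<open>auto simp: E_def\<close>)
  next
    fix z assume "z \<in> E \<union> C"
    then consider s where "0 < s" "s < 1" "a + s *\<^sub>R (z - a) \<in> C" | "z \<in> C"
      by (auto simp: E_def)
    then show "z \<in> {z. \<exists>s. s \<in> {0..1} \<and> (s, z) \<in> {p. a + fst p *\<^sub>R (snd p - a) \<in> C}}"
    proof cases
      case 1
      then show ?thesis by (auto intro!: exI[where x = s])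
    next
      case 2
      then show ?thesis by (auto intro!: exI[where x = 1])
    qed
  qed
  moreover have "closed {p. a + fst p *\<^sub>R (snd p - a) \<in> C}"
    by (rule closed_vimage[unfolded vimage_def])
       (auto intro!: continuous_intros compact_imp_closed C)
  ultimately have closedEC: "closed (E \<union> C)"
    using closed_compact_projection[of "{0..1::real}" "{p. a + fst p *\<^sub>R (snd p - a) \<in> C}"] by simp
  have compl: "- C = I \<union> E" using cover IC EC by auto
  have "I = - (E \<union> C)" "E = - (I \<union> C)" using cover IC EC IE by auto
  then have opens: "open I" "open E"
    using closedEC compact_imp_closed[OF compIC] by (metis open_Compl)+
  \<comment> \<open>\<open>I\<close> and \<open>E\<close> are disjoint open sets covering the
    complement of \<open>C\<close>, so a component that meets \<open>I\<close> cannot leave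
    it.\<close>
  have star: "connected_component_set (- C) z \<subseteq> I" if "z \<in> I" for z
  proof -
    define K where "K = connected_component_set (- C) z"
    have "K \<subseteq> - C" "connected K" unfolding K_def
      by (auto simp: connected_component_subset)
    moreover have "z \<in> K" using that IC unfolding K_def by auto
    ultimately have "K \<inter> E = {}"
      using connectedD[of K I E] opens IE compl that by auto
    then show ?thesis using \<open>K \<subseteq> - C\<close> compl K_def by auto
  qed
  have bI: "bounded I" using compact_imp_bounded[OF compIC] by (rule bounded_subset) auto
  have "I \<subseteq> inside C"
    using IC bounded_subset[OF bI star] by (auto simp: inside_def)
  moreover have "E \<subseteq> outside C"
  proof
    fix z assume z: "z \<in> E"
    then have za: "z \<noteq> a" using IE by (auto simp: I_def)
    \<comment> \<open>The part of the ray from \<open>z\<close> outwards: it avoids \<open>C\<close>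
      because the only crossing happens at a factor below \<open>1\<close>, and it is
      unbounded.\<close>
    define L where "L = (\<lambda>t. a + t *\<^sub>R (z - a)) ` {1..}"
    have "connected L" unfolding L_def
      by (intro connected_continuous_image continuous_intros) auto
    moreover have "z \<in> L" unfolding L_def by (rule image_eqI[where x = 1]) auto
    moreover have "L \<inter> C = {}"
    proof -
      obtain s where s: "0 < s" "s < 1" "a + s *\<^sub>R (z - a) \<in> C" using z by (auto simp: E_def)
      have "False" if "t \<ge> 1" "a + t *\<^sub>R (z - a) \<in> C" for t
        using unique[OF _ _ s(3) that(2)] s that by simp
      then show ?thesis by (auto simp: L_def)
    qed
    ultimately have "L \<subseteq> connected_component_set (- C) z"
      by (intro connected_component_maximal) auto
    moreover have "\<not> bounded L"
    proof
      assume "bounded L"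
      then obtain b where b: "\<And>x. x \<in> L \<Longrightarrow> norm x \<le> b" by (auto simp: bounded_iff)
      define t where "t = max 1 ((b + norm a + 1) / norm (z - a))"
      have "norm (t *\<^sub>R (z - a)) \<le> norm (a + t *\<^sub>R (z - a)) + norm a"
        by (metis add.commute norm_add_leD order_refl)
      also have "\<dots> \<le> b + norm a"
      proof -
        have "a + t *\<^sub>R (z - a) \<in> L" unfolding L_def by (intro imageI) (simp add: t_def)
        then show ?thesis using b by simp
      qed
      finally have "t * norm (z - a) \<le> b + norm a" by (simp add: t_def)
      moreover have "t * norm (z - a) \<ge> b + norm a + 1"
        using za by (simp add: t_def pos_divide_le_eq[symmetric])
      ultimately show False by simp
    qed
    ultimately show "z \<in> outside C"
      using z EC by (auto simp: outside_def dest: bounded_subset)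
  qed
  ultimately have "inside C = I"
    using compl inside_no_overlap[of C] inside_Int_outside[of C] by blast
  then show "inside C = insert a {z. \<exists>s>1. a + s *\<^sub>R (z - a) \<in> C}"
    unfolding I_def .
qed

section \<open>The determinant and the curve\<close>

text \<open>These are the \<open>V\<^sub>k\<close> of the opening comment; the factor
  \<open>d!\<close> separates them from the binomial basis.\<close>

definition shifted_prod :: "nat \<Rightarrow> nat \<Rightarrow> complex \<Rightarrow> complex" where
  "shifted_prod d k z = (\<Prod>i<d. z + of_nat d - of_nat k - of_nat i)"

lemma gchoose_shifted_prod:
  "(z + of_nat d - of_nat k) gchoose d = shifted_prod d k z / fact d"
  by (simp add: gbinomial_prod_rev shifted_prod_def atLeast0LessThan)

text \<open>Both sides are the product of the \<open>d + 1\<close> consecutive factors from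
  \<open>z + d - k\<close> down to \<open>z - k\<close>.\<close>

lemma shifted_prod_Suc:
  "shifted_prod d (Suc k) z * (z + of_nat d - of_nat k) = shifted_prod d k z * (z - of_nat k)"
proof -
  have "(\<Prod>i<Suc d. z + of_nat d - of_nat k - of_nat i)
      = (z + of_nat d - of_nat k) * (\<Prod>i<d. z + of_nat d - of_nat k - of_nat (Suc i))"
    by (subst prod.lessThan_Suc_shift) simp
  also have "(\<Prod>i<d. z + of_nat d - of_nat k - of_nat (Suc i)) = shifted_prod d (Suc k) z"
    by (simp add: shifted_prod_def algebra_simps)
  finally show ?thesis
    by (simp add: shifted_prod_def mult.commute)
qed

lemma shifted_prod_cnj: "shifted_prod d k (cnj z) = cnj (shifted_prod d k z)"
  by (simp add: shifted_prod_def)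

lemma shifted_prod_nonzero:
  assumes "Im z \<noteq> 0"
  shows "shifted_prod d k z \<noteq> 0"
proof -
  have "Im (z + of_nat d - of_nat k - of_nat i) \<noteq> 0" for i using assms by simp
  then have "z + of_nat d - of_nat k - of_nat i \<noteq> 0" for i
    by (metis zero_complex.simps(2))
  then show ?thesis by (simp add: shifted_prod_def)
qed

section \<open>The three-term relation and the continuants\<close>

text \<open>The leading principal minors of the matrix in \<open>D0\<close>. Their size
  \<open>n\<close> is decoupled from \<open>d\<close>, so that the continuant recurrence can be
  stated for fixed \<open>d\<close>.\<close>

definition curve_tridiag :: "nat \<Rightarrow> real \<Rightarrow> real \<Rightarrow> nat \<Rightarrow> real" where
  "curve_tridiag d x y n = Determinant.det (mat n n (\<lambda>(i, j).
     if i = j then - q_entry d i x y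
     else if j = i + 1 then p_entry j x y
     else if i = j + 1 then r_entry d j x y
     else 0))"

lemma curve_tridiag_rec:
  "curve_tridiag d x y 0 = 1"
  "curve_tridiag d x y (Suc 0) = - q_entry d 0 x y"
  "curve_tridiag d x y (Suc (Suc n)) = - q_entry d (Suc n) x y * curve_tridiag d x y (Suc n)
     - p_entry (Suc n) x y * r_entry d n x y * curve_tridiag d x y n"
  unfolding curve_tridiag_def
  by (rule det_tridiagonal[where a = "\<lambda>i. - q_entry d i x y" and b = "\<lambda>j. p_entry j x y"
        and c = "\<lambda>j. r_entry d j x y"])+

lemma continuous_on_curve_tridiag [continuous_intros]:
  "continuous_on UNIV (\<lambda>z. curve_tridiag d (Re z) (Im z) n)"
proof (induction n rule: less_induct)
  case (less n)
  consider "n = 0" | "n = Suc 0" | m where "n = Suc (Suc m)" by (metis not0_implies_Suc)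
  then show ?case
    by cases (auto simp: curve_tridiag_rec q_entry_def p_entry_def r_entry_def
        intro!: continuous_intros less)
qed

text \<open>The oriented area spanned by two plane vectors; it is positive when \<open>v\<close>
  lies strictly to the left of \<open>u\<close>.\<close>

definition cross :: "complex \<Rightarrow> complex \<Rightarrow> real" where
  "cross u v = Im (cnj u * v)"

text \<open>Both neighbours of \<open>V = shifted_prod d (Suc m) z\<close> are \<open>V\<close>
  times a quotient of linear factors, while \<open>p_entry\<close> and \<open>r_entry\<close> are
  the squared moduli of the denominators. After cancellation a polynomial identity in
  \<open>a\<close> and \<open>cnj a\<close> remains, and it produces the term
  \<open>d (d - 1)\<close> in \<open>q_entry\<close>.\<close>

lemma shifted_prod_three_term:
  fixes d m :: nat
  assumes y: "Im z \<noteq> 0"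
  shows "of_real (p_entry m (Re z) (Im z)) * shifted_prod d m z
      - of_real (q_entry d m (Re z) (Im z)) * shifted_prod d (Suc m) z
      + of_real (r_entry d m (Re z) (Im z)) * shifted_prod d (Suc (Suc m)) z = 0"
proof -
  define a where "a = z - of_nat m"
  define e where "e = a + of_nat d - 1"
  have nz: "a \<noteq> 0" "e \<noteq> 0" using y by (auto simp: a_def e_def complex_eq_iff)
  define V where "V = shifted_prod d (Suc m) z"
  have 1: "shifted_prod d m z = V * (e + 1) / a"
    using shifted_prod_Suc[of d m z] nz by (simp add: V_def field_simps a_def e_def)
  have 2: "shifted_prod d (Suc (Suc m)) z = V * (a - 1) / e"
    using shifted_prod_Suc[of d "Suc m" z] nz by (simp add: V_def field_simps a_def e_def)
  have p: "of_real (p_entry m (Re z) (Im z)) = a * cnj a"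
    unfolding complex_norm_square[symmetric] by (simp only: cmod_power2) (simp add: p_entry_def a_def)
  have r: "of_real (r_entry d m (Re z) (Im z)) = e * cnj e"
    unfolding complex_norm_square[symmetric]
    by (simp only: cmod_power2) (simp add: r_entry_def e_def a_def algebra_simps)
  have q: "of_real (q_entry d m (Re z) (Im z)) = a * cnj a + e * cnj e - of_nat d * (of_nat d - 1)"
    by (simp add: q_entry_def p r del: complex_cnj_mult)
  have "cnj a * (e + 1) - (a * cnj a + e * cnj e - of_nat d * (of_nat d - 1)) + cnj e * (a - 1) = 0"
    by (simp add: e_def algebra_simps)
  then have "V * (cnj a * (e + 1) - (a * cnj a + e * cnj e - of_nat d * (of_nat d - 1)) + cnj e * (a - 1)) = 0"
    by simp
  moreover have "a * cnj a * (V * (e + 1) / a) = V * (cnj a * (e + 1))"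
    "e * cnj e * (V * (a - 1) / e) = V * (cnj e * (a - 1))"
    using nz by simp_all
  ultimately show ?thesis
    unfolding V_def[symmetric] 1 2 p q r by (simp only: distrib_left right_diff_distrib mult.commute)
qed

text \<open>The two products share all factors but one; the squared modulus of the common part
  \<open>M\<close> is the product of the \<open>r_entry\<close> values. This is the initial value
  for the recurrence below.\<close>

lemma cross_shifted_prod_one:
  assumes "Im z \<noteq> 0"
  shows "cross (shifted_prod (Suc n) 0 z) (shifted_prod (Suc n) 1 z)
    = real (Suc n) * Im z * (\<Prod>m<n. r_entry (Suc n) m (Re z) (Im z))"
proof -
  define M where "M = (\<Prod>i<n. z + of_nat n - of_nat i)"
  have 0: "shifted_prod (Suc n) 0 z = (z + of_nat (Suc n)) * M"
    unfolding shifted_prod_def M_def by (subst prod.lessThan_Suc_shift) (simp add: add_diff_eq)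
  have 1: "shifted_prod (Suc n) 1 z = z * M"
  proof -
    have "z + of_nat (Suc n) - of_nat 1 - of_nat i = z + of_nat n - of_nat i" for i by simp
    then show ?thesis unfolding shifted_prod_def M_def by simp
  qed
  have "(norm M)\<^sup>2 = (\<Prod>m<n. (norm (z + of_nat n - of_nat m))\<^sup>2)"
    by (simp add: M_def prod_norm[symmetric] prod_power_distrib)
  also have "\<dots> = (\<Prod>m<n. r_entry (Suc n) m (Re z) (Im z))"
    by (intro prod.cong) (simp_all add: cmod_power2 r_entry_def algebra_simps)
  finally have M: "(norm M)\<^sup>2 = (\<Prod>m<n. r_entry (Suc n) m (Re z) (Im z))" .
  have "cnj (shifted_prod (Suc n) 0 z) * shifted_prod (Suc n) 1 z
     = of_real ((norm M)\<^sup>2) * (cnj (z + of_nat (Suc n)) * z)"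
    unfolding 0 1 complex_norm_square by (simp add: algebra_simps)
  moreover have "Im (of_real t * w) = t * Im w" for t w by simp
  ultimately have "cross (shifted_prod (Suc n) 0 z) (shifted_prod (Suc n) 1 z)
     = (norm M)\<^sup>2 * Im (cnj (z + of_nat (Suc n)) * z)"
    unfolding cross_def by metis
  also have "Im (cnj (z + of_nat (Suc n)) * z) = real (Suc n) * Im z"
    by (simp add: algebra_simps)
  finally show ?thesis
    unfolding M by (simp add: mult_ac)
qed

text \<open>The coefficients of the three-term relation are real, so taking \<open>cross\<close>
  with the fixed vector \<open>shifted_prod d 0 z\<close> preserves it. Multiplying by the
  \<open>r_entry\<close> values avoids division and leaves the continuant recurrence; the sign comes
  from the negated diagonal.\<close>

lemma cross_shifted_prod_tridiag:
  assumes y: "Im z \<noteq> 0"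
  shows "cross (shifted_prod d 0 z) (shifted_prod d (Suc n) z) * (\<Prod>m<n. r_entry d m (Re z) (Im z))
    = (-1) ^ n * curve_tridiag d (Re z) (Im z) n * cross (shifted_prod d 0 z) (shifted_prod d 1 z)"
proof -
  define s where "s k = cross (shifted_prod d 0 z) (shifted_prod d k z)" for k
  define p where "p m = p_entry m (Re z) (Im z)" for m
  define q where "q m = q_entry d m (Re z) (Im z)" for m
  define r where "r m = r_entry d m (Re z) (Im z)" for m
  define T where "T n = curve_tridiag d (Re z) (Im z) n" for n
  have s0: "s 0 = 0" by (simp add: s_def cross_def)
  have rec: "p m * s m - q m * s (Suc m) + r m * s (Suc (Suc m)) = 0" for m
  proof -
    have "0 = Im (cnj (shifted_prod d 0 z) * (of_real (p m) * shifted_prod d m z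
      - of_real (q m) * shifted_prod d (Suc m) z + of_real (r m) * shifted_prod d (Suc (Suc m)) z))"
      unfolding p_def q_def r_def shifted_prod_three_term[OF y] by simp
    then show ?thesis by (simp add: s_def cross_def algebra_simps)
  qed
  have "s (Suc n) * (\<Prod>m<n. r m) = (-1) ^ n * T n * s 1"
  proof (induction n rule: less_induct)
    case (less n)
    consider "n = 0" | "n = Suc 0" | m where "n = Suc (Suc m)" by (metis not0_implies_Suc)
    then show ?case
    proof cases
      case 1
      then show ?thesis by (simp add: T_def curve_tridiag_rec)
    next
      case 2
      then show ?thesis using rec[of 0] s0
        by (simp add: mult.commute) (simp add: T_def curve_tridiag_rec q_def[symmetric])
    next
      case (3 m)
      let ?R = "\<Prod>i<m. r i"
      have I1: "s (Suc m) * ?R = (-1) ^ m * T m * s 1" using less[of m] 3 by simp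
      have I2: "s (Suc (Suc m)) * (?R * r m) = - ((-1) ^ m * T (Suc m) * s 1)"
        using less[of "Suc m"] 3 by simp
      have T: "T n = - q (Suc m) * T (Suc m) - p (Suc m) * r m * T m"
        unfolding 3 T_def curve_tridiag_rec q_def p_def r_def ..
      have "s (Suc n) * (\<Prod>i<n. r i) = (r (Suc m) * s (Suc (Suc (Suc m)))) * (?R * r m)"
        by (simp add: 3)
      also have "r (Suc m) * s (Suc (Suc (Suc m))) = q (Suc m) * s (Suc (Suc m)) - p (Suc m) * s (Suc m)"
        using rec[of "Suc m"] by simp
      also have "\<dots> * (?R * r m) = q (Suc m) * (s (Suc (Suc m)) * (?R * r m))
          - p (Suc m) * r m * (s (Suc m) * ?R)" by (simp add: algebra_simps)
      also have "\<dots> = (-1) ^ n * T n * s 1" unfolding I1 I2 T by (simp add: 3 algebra_simps)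
      finally show ?thesis .
    qed
  qed
  then show ?thesis by (simp add: s_def r_def T_def)
qed

text \<open>For \<open>n = d - 1\<close> the product of the \<open>r_entry\<close> values occurs on
  both sides, and off the real axis it can be cancelled.\<close>

lemma cross_shifted_prod_D0:
  assumes y: "Im z \<noteq> 0" and d: "d \<ge> 1"
  shows "cross (shifted_prod d 0 z) (shifted_prod d d z)
    = (-1) ^ (d - 1) * real d * Im z * D0 d (Re z) (Im z)"
proof -
  obtain n where n: "d = Suc n" using d by (cases d) auto
  have "r_entry d m (Re z) (Im z) \<noteq> 0" for m
    using y by (simp add: r_entry_def add_nonneg_eq_0_iff)
  then have "(\<Prod>m<n. r_entry d m (Re z) (Im z)) \<noteq> 0" by simp
  then show ?thesis
    using cross_shifted_prod_tridiag[OF y, of d n] cross_shifted_prod_one[OF y, of n]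
    by (simp add: n D0_def curve_tridiag_def[symmetric])
qed

lemma continuous_on_D0: "continuous_on UNIV (\<lambda>z. D0 d (Re z) (Im z))"
  unfolding D0_def curve_tridiag_def[symmetric] by (rule continuous_on_curve_tridiag)

section \<open>The defining quotient and its extension to the real axis\<close>

text \<open>The numerator has the form \<open>w - cnj w\<close>, so numerator and denominator are
  both \<open>2 \<i>\<close> times an imaginary part.\<close>

lemma curve_quotient_eq:
  assumes y: "Im z \<noteq> 0" and d: "d \<ge> 1"
  shows "curve_quotient d z = of_real ((-1) ^ (d - 1) * real d / (fact d)\<^sup>2 * D0 d (Re z) (Im z))"
proof -
  define u where "u = shifted_prod d 0 z"
  define v where "v = shifted_prod d d z"
  have "z gchoose d = v / fact d" "(z + of_nat d) gchoose d = u / fact d"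
    using gchoose_shifted_prod[of z d d] gchoose_shifted_prod[of z d 0] by (simp_all add: u_def v_def)
  then have "curve_quotient d z = (cnj u * v - cnj (cnj u * v)) / (fact d)\<^sup>2 / (z - cnj z)"
    by (simp add: curve_quotient_def power2_eq_square diff_divide_distrib mult.commute)
  also have "\<dots> = of_real (cross u v / (fact d)\<^sup>2 / Im z)"
  proof -
    have "(w - cnj w) / (fact d)\<^sup>2 / (z - cnj z) = of_real (Im w / (fact d)\<^sup>2 / Im z)" for w
      using y by (simp add: complex_diff_cnj)
    then show ?thesis unfolding cross_def .
  qed
  also have "\<dots> = of_real ((-1) ^ (d - 1) * real d / (fact d)\<^sup>2 * D0 d (Re z) (Im z))"
    using cross_shifted_prod_D0[OF y d] y by (simp add: u_def v_def)
  finally show ?thesis .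
qed

text \<open>Makes the limit in \<open>curve_poly\<close> unique, and later gives density of the
  non-real points.\<close>

lemma not_trivial_limit_nonreal: "at z within (- \<real>) \<noteq> bot" for z :: complex
proof -
  have "z islimpt (- \<real>)"
  proof (rule islimpt_approachable[THEN iffD2], intro allI impI)
    fix e :: real assume e: "e > 0"
    show "\<exists>x'\<in>- \<real>. x' \<noteq> z \<and> dist x' z < e"
    proof (cases "z \<in> \<real>")
      case True
      then show ?thesis using e
        by (intro bexI[where x = "z + \<i> * of_real (e / 2)"])
           (auto simp: dist_norm complex_is_Real_iff norm_mult)
    next
      case False
      define t where "t = min e \<bar>Im z\<bar> / 2"
      have "t > 0" "t < e" "t < \<bar>Im z\<bar>" using e False by (auto simp: t_def complex_is_Real_iff)
      then show ?thesis using False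
        by (intro bexI[where x = "z + of_real t"])
           (auto simp: dist_norm complex_is_Real_iff)
    qed
  qed
  then show ?thesis by (simp add: trivial_limit_within)
qed

text \<open>The right-hand side is continuous on the whole plane and equals the quotient off the
  real axis, so at a real point it is the limit of the quotient.\<close>

lemma curve_poly_eq:
  assumes d: "d \<ge> 1"
  shows "curve_poly d z = of_real ((-1) ^ (d - 1) * real d / (fact d)\<^sup>2 * D0 d (Re z) (Im z))"
proof (cases "z \<in> \<real>")
  case False
  then show ?thesis using curve_quotient_eq[OF _ d, of z] by (simp add: curve_poly_def complex_is_Real_iff)
next
  case True
  define g where "g z = complex_of_real ((-1) ^ (d - 1) * real d / (fact d)\<^sup>2 * D0 d (Re z) (Im z))" for z
  have "continuous_on UNIV g" unfolding g_def
    by (intro continuous_intros continuous_on_D0)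
  then have "(g \<longlongrightarrow> g z) (at z)" by (simp add: continuous_on_def)
  then have "(g \<longlongrightarrow> g z) (at z within - \<real>)"
    by (rule tendsto_within_subset) simp
  moreover have "eventually (\<lambda>w. g w = curve_quotient d w) (at z within - \<real>)"
    using curve_quotient_eq[OF _ d] by (auto simp: eventually_at_filter g_def complex_is_Real_iff)
  ultimately have "(curve_quotient d \<longlongrightarrow> g z) (at z within - \<real>)"
    by (rule Lim_transform_eventually)
  then have "Lim (at z within - \<real>) (curve_quotient d) = g z"
    by (intro tendsto_Lim not_trivial_limit_nonreal)
  then show ?thesis using True by (simp add: curve_poly_def g_def)
qed

lemma curve_eq_D0:
  assumes "d \<ge> 1"
  shows "curve d = {z. D0 d (Re z) (Im z) = 0}"
  using assms by (simp add: curve_def curve_poly_eq)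

section \<open>The curve as a polynomial in the squared modulus and the imaginary part\<close>

definition half_odd :: "nat \<Rightarrow> real" where
  "half_odd j = real j + 1 / 2"

lemma half_odd_pos [simp]: "0 < half_odd j"
  by (simp add: half_odd_def)

lemma half_odd_less [simp]: "half_odd i < half_odd j \<longleftrightarrow> i < j"
  by (simp add: half_odd_def)

lemma half_odd_sq_less [simp]: "(half_odd i)\<^sup>2 < (half_odd j)\<^sup>2 \<longleftrightarrow> i < j"
  using half_odd_pos[of i] half_odd_pos[of j]
  by (metis half_odd_less less_eq_real_def power_less_imp_less_base power_strict_mono zero_less_numeral)

lemma half_odd_sq_eq [simp]: "(half_odd i)\<^sup>2 = (half_odd j)\<^sup>2 \<longleftrightarrow> i = j"
  by (metis half_odd_sq_less less_irrefl nat_neq_iff)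

lemma half_odd_sq_le [simp]: "(half_odd i)\<^sup>2 \<le> (half_odd j)\<^sup>2 \<longleftrightarrow> i \<le> j"
  by (metis half_odd_sq_less linorder_not_less)

text \<open>After the shift by \<open>1 / 2\<close> the zeros of the two products are opposite to
  each other. Reading the factors of \<open>shifted_prod d 0 z\<close> backwards pairs them
  up.\<close>

lemma cnj_shifted_prod_mult:
  "cnj (shifted_prod d 0 z) * shifted_prod d d z
    = (\<Prod>j<d. (z + 1 / 2 - of_real (half_odd j)) * cnj (z + 1 / 2 + of_real (half_odd j)))"
proof -
  have "shifted_prod d 0 z = (\<Prod>i<d. z + of_nat d - of_nat (d - Suc i))"
    unfolding shifted_prod_def by (subst prod.nat_diff_reindex[symmetric]) simp
  also have "\<dots> = (\<Prod>j<d. z + 1 / 2 + of_real (half_odd j))"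
    by (intro prod.cong) (auto simp: half_odd_def of_nat_diff)
  finally have 0: "shifted_prod d 0 z = (\<Prod>j<d. z + 1 / 2 + of_real (half_odd j))" .
  have "shifted_prod d d z = (\<Prod>j<d. z + 1 / 2 - of_real (half_odd j))"
    unfolding shifted_prod_def by (intro prod.cong) (auto simp: half_odd_def)
  then show ?thesis
    unfolding 0 by (simp add: prod.distrib mult.commute)
qed

text \<open>\<open>oval_re n t y + \<i> y oval_im n t y\<close> is the product of \<open>t - c\<^sub>j\<^sup>2 + 2 \<i> c\<^sub>j y\<close> over \<open>j < n\<close>;
  unlike the quotient by \<open>y\<close>, \<open>oval_im\<close> makes sense on the real axis.\<close>

fun oval_re oval_im :: "nat \<Rightarrow> real \<Rightarrow> real \<Rightarrow> real" where
  "oval_re 0 t y = 1"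
| "oval_im 0 t y = 0"
| "oval_re (Suc n) t y = (t - (half_odd n)\<^sup>2) * oval_re n t y - 2 * half_odd n * y\<^sup>2 * oval_im n t y"
| "oval_im (Suc n) t y = (t - (half_odd n)\<^sup>2) * oval_im n t y + 2 * half_odd n * oval_re n t y"

text \<open>Because of this form the curve depends on \<open>w\<close> only through its squared
  modulus and its imaginary part.\<close>

lemma sub_mult_cnj_add:
  "(w - of_real c) * cnj (w + of_real c) = Complex ((norm w)\<^sup>2 - c\<^sup>2) (2 * c * Im w)"
proof -
  have "(norm w)\<^sup>2 = (Re w)\<^sup>2 + (Im w)\<^sup>2" by (rule cmod_power2)
  then show ?thesis by (simp add: complex_eq_iff power2_eq_square algebra_simps)
qed

lemma prod_sub_mult_cnj_add:
  "(\<Prod>j<n. (w - of_real (half_odd j)) * cnj (w + of_real (half_odd j)))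
    = Complex (oval_re n ((norm w)\<^sup>2) (Im w)) (Im w * oval_im n ((norm w)\<^sup>2) (Im w))"
  unfolding sub_mult_cnj_add
  by (induction n) (auto simp: complex_eq_iff power2_eq_square algebra_simps)

lemma continuous_on_oval:
  "continuous_on UNIV (\<lambda>z. oval_re n ((norm (z + 1 / 2))\<^sup>2) (Im z))"
  "continuous_on UNIV (\<lambda>z. oval_im n ((norm (z + 1 / 2))\<^sup>2) (Im z))"
  by (induction n) (auto intro!: continuous_intros)

lemma dense_nonreal: "closure (- \<real>) = (UNIV :: complex set)"
  using not_trivial_limit_nonreal by (auto simp: trivial_limit_within closure_def)

text \<open>Multiplied by \<open>Im z\<close>, both sides are the imaginary part of the same
  product. Off the real axis \<open>Im z\<close> cancels; continuity and density of the non-real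
  points give the rest.\<close>

lemma D0_eq_oval_im:
  assumes d: "d \<ge> 1"
  shows "(-1) ^ (d - 1) * real d * D0 d (Re z) (Im z) = oval_im d ((norm (z + 1 / 2))\<^sup>2) (Im z)"
proof -
  let ?S = "{z. (-1) ^ (d - 1) * real d * D0 d (Re z) (Im z) = oval_im d ((norm (z + 1 / 2))\<^sup>2) (Im z)}"
  have "closed ?S"
    by (intro closed_Collect_eq continuous_intros continuous_on_D0 continuous_on_oval)
  moreover have "- \<real> \<subseteq> ?S"
  proof
    fix z :: complex assume "z \<in> - \<real>"
    then have y: "Im z \<noteq> 0" by (simp add: complex_is_Real_iff)
    have "Im z * ((-1) ^ (d - 1) * real d * D0 d (Re z) (Im z))
        = Im z * oval_im d ((norm (z + 1 / 2))\<^sup>2) (Im z)"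
      using cross_shifted_prod_D0[OF y d, symmetric]
      unfolding cross_def cnj_shifted_prod_mult prod_sub_mult_cnj_add by (simp add: mult_ac del: mult_cancel_left)
    then have "(-1) ^ (d - 1) * real d * D0 d (Re z) (Im z) = oval_im d ((norm (z + 1 / 2))\<^sup>2) (Im z)"
      using y by (metis mult_left_cancel)
    then show "z \<in> ?S" by simp
  qed
  ultimately have "closure (- \<real>) \<subseteq> ?S" by (rule closure_minimal[rotated])
  then show ?thesis unfolding dense_nonreal by auto
qed

lemma curve_eq_oval_im:
  assumes d: "d \<ge> 1"
  shows "curve d = {z. oval_im d ((norm (z + 1 / 2))\<^sup>2) (Im z) = 0}"
  using d by (auto simp: curve_eq_D0 D0_eq_oval_im[symmetric])

lemma closed_curve:
  assumes "d \<ge> 1"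
  shows "closed (curve d)"
  unfolding curve_eq_oval_im[OF assms] by (intro closed_Collect_eq continuous_intros continuous_on_oval)

section \<open>The curve on the real axis\<close>

lemma oval_re_real: "oval_re n t 0 = (\<Prod>j<n. t - (half_odd j)\<^sup>2)"
  by (induction n) (auto simp: mult.commute)

text \<open>To first order in \<open>y\<close> the product of the
  \<open>t - c\<^sub>j\<^sup>2 + 2 \<i> c\<^sub>j y\<close> behaves by the product rule, so this sum
  is a logarithmic derivative.\<close>

lemma oval_im_real:
  assumes "\<And>j. j < n \<Longrightarrow> t \<noteq> (half_odd j)\<^sup>2"
  shows "oval_im n t 0 = oval_re n t 0 * (\<Sum>j<n. 2 * half_odd j / (t - (half_odd j)\<^sup>2))"
  using assms
proof (induction n)
  case (Suc n)
  have "t - (half_odd n)\<^sup>2 \<noteq> 0" using Suc.prems[of n] by simp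
  then show ?case using Suc by (simp add: algebra_simps) (simp add: field_simps)
qed simp

text \<open>At \<open>y = 0\<close> the value is a sum over \<open>j\<close> of
  \<open>2 * half_odd j\<close> times the product of the remaining factors; only the summand
  omitting the vanishing factor survives.\<close>

lemma oval_im_real_half_odd:
  assumes "k < n"
  shows "oval_im n ((half_odd k)\<^sup>2) 0 \<noteq> 0"
  using assms
proof (induction n)
  case (Suc n)
  show ?case
  proof (cases "k = n")
    case True
    then show ?thesis using half_odd_pos[of n, THEN less_imp_neq] by (auto simp: oval_re_real)
  next
    case False
    then have "k < n" using Suc by simp
    then have "oval_re n ((half_odd k)\<^sup>2) 0 = 0" by (force simp: oval_re_real)
    then show ?thesis using Suc \<open>k < n\<close> by simp
  qed
qed simp

lemma oval_im_real_pos: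
  assumes "\<And>j. j < n \<Longrightarrow> (half_odd j)\<^sup>2 < t" "n \<ge> 1"
  shows "oval_im n t 0 > 0"
proof -
  have "oval_re n t 0 > 0" using assms by (auto simp: oval_re_real intro!: prod_pos)
  moreover have "(\<Sum>j<n. 2 * half_odd j / (t - (half_odd j)\<^sup>2)) > 0"
    using assms by (intro sum_pos) (auto simp: lessThan_empty_iff)
  ultimately show ?thesis using assms by (subst oval_im_real) force+
qed

text \<open>On the real axis the angle is a step function and cannot single out a point of each ray;
  this root takes its place. Existence follows from a sign change over the gap, uniqueness from
  strict decrease of the sum in \<open>oval_im_real\<close> between its poles.\<close>

lemma oval_im_real_root:
  "\<exists>!t. (half_odd n)\<^sup>2 < t \<and> t < (half_odd (Suc n))\<^sup>2 \<and> oval_im (Suc (Suc n)) t 0 = 0"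
proof -
  let ?a = "(half_odd n)\<^sup>2" and ?b = "(half_odd (Suc n))\<^sup>2"
  let ?f = "\<lambda>t. oval_im (Suc (Suc n)) t 0"
  have cont: "continuous_on A (\<lambda>t. oval_im n t 0)" "continuous_on A (\<lambda>t. oval_re n t 0)" for A n
    by (induction n) (auto intro!: continuous_intros)
  have re_pos: "oval_re n ?a 0 > 0" "oval_re (Suc n) ?b 0 > 0"
    by (auto simp: oval_re_real simp del: prod.lessThan_Suc intro!: prod_pos)
  have "oval_im (Suc n) ?a 0 > 0" using re_pos by simp
  \<comment> \<open>At the left end \<open>oval_re (Suc n)\<close> vanishes, so only the first term
    of the recursion is left, with a negative and a positive factor.\<close>
  then have fa: "?f ?a < 0"
    by (auto simp del: oval_im.simps simp: oval_im.simps(2)[of "Suc n"] oval_re_real[of "Suc n"] mult_less_0_iff)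
  have fb: "?f ?b > 0" using re_pos(2) by (simp del: oval_re.simps)
  have ab: "?a < ?b" by simp
  obtain t where t: "?a \<le> t" "t \<le> ?b" "?f t = 0"
    using IVT'[of ?f ?a 0 ?b] fa fb ab cont(1)[of _ "Suc (Suc n)"] by (meson less_imp_le)
  then have "t \<noteq> ?a" "t \<noteq> ?b" using fa fb by auto
  with t have ex: "?a < t \<and> t < ?b \<and> ?f t = 0" by simp
  have decr: "False" if "?a < s" "s < t" "t < ?b" "?f s = 0" "?f t = 0" for s t
  proof -
    have nz: "u \<noteq> (half_odd j)\<^sup>2" if "?a < u" "u < ?b" "j < Suc (Suc n)" for u j
    proof
      assume "u = (half_odd j)\<^sup>2"
      then have "n < j" "j < Suc n" using that by simp_all
      then show False by simp
    qed
    have zero: "(\<Sum>j<Suc (Suc n). 2 * half_odd j / (u - (half_odd j)\<^sup>2)) = 0" if "?a < u" "u < ?b" "?f u = 0" for u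
    proof -
      have "oval_re (Suc (Suc n)) u 0 \<noteq> 0" using nz[OF that(1,2)] by (simp add: oval_re_real del: prod.lessThan_Suc)
      then show ?thesis using oval_im_real[of "Suc (Suc n)" u] nz[OF that(1,2)] that(3)
        by (metis mult_eq_0_iff)
    qed
    have "(\<Sum>j<Suc (Suc n). 2 * half_odd j / (t - (half_odd j)\<^sup>2))
        < (\<Sum>j<Suc (Suc n). 2 * half_odd j / (s - (half_odd j)\<^sup>2))"
    proof (rule sum_strict_mono)
      fix j assume j: "j \<in> {..<Suc (Suc n)}"
      show "2 * half_odd j / (t - (half_odd j)\<^sup>2) < 2 * half_odd j / (s - (half_odd j)\<^sup>2)"
      proof (cases "j = Suc n")
        case True
        then show ?thesis using that(1-3)
          by (intro divide_strict_left_mono) (auto intro: mult_neg_neg)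
      next
        case False
        then have "(half_odd j)\<^sup>2 \<le> ?a"
          using j by simp
        then have "0 < s - (half_odd j)\<^sup>2" "0 < t - (half_odd j)\<^sup>2" using that(1-3) by linarith+
        then show ?thesis using that(2)
          by (intro divide_strict_left_mono mult_pos_pos[of "t - _"]) auto
      qed
    qed auto
    then show False using zero[of s] zero[of t] that by simp
  qed
  show ?thesis
    using ex decr by (metis linorder_neqE)
qed

section \<open>Angles subtended by segments\<close>

text \<open>Written with \<open>arccos\<close> instead of \<open>Arg\<close>, the angle is symmetric
  under conjugation and continuous away from the two endpoints, also on the real axis. At an
  endpoint the quotient is \<open>0 / 0 = 0\<close> and the value is \<open>pi / 2\<close>.\<close>

definition segment_angle :: "real \<Rightarrow> complex \<Rightarrow> real" where
  "segment_angle c w = arccos (((norm w)\<^sup>2 - c\<^sup>2) / norm ((w - of_real c) * cnj (w + of_real c)))"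

lemma segment_angle_quotient_bounds:
  "-1 \<le> ((norm w)\<^sup>2 - c\<^sup>2) / norm ((w - of_real c) * cnj (w + of_real c))"
  "((norm w)\<^sup>2 - c\<^sup>2) / norm ((w - of_real c) * cnj (w + of_real c)) \<le> 1"
proof -
  have "\<bar>(norm w)\<^sup>2 - c\<^sup>2\<bar> \<le> norm ((w - of_real c) * cnj (w + of_real c))"
    using abs_Re_le_cmod[of "(w - of_real c) * cnj (w + of_real c)"]
    by (simp only: sub_mult_cnj_add complex.sel)
  then have "\<bar>((norm w)\<^sup>2 - c\<^sup>2) / norm ((w - of_real c) * cnj (w + of_real c))\<bar> \<le> 1"
    unfolding abs_divide abs_norm_cancel
    by (cases "norm ((w - of_real c) * cnj (w + of_real c)) = 0") (simp_all only: divide_le_eq_1 div_by_0, auto simp: less_le)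
  then show "-1 \<le> ((norm w)\<^sup>2 - c\<^sup>2) / norm ((w - of_real c) * cnj (w + of_real c))"
    "((norm w)\<^sup>2 - c\<^sup>2) / norm ((w - of_real c) * cnj (w + of_real c)) \<le> 1"
    by (simp_all only: abs_le_iff minus_le_iff)
qed

lemma segment_angle_bounds: "0 \<le> segment_angle c w" "segment_angle c w \<le> pi"
  unfolding segment_angle_def
  using segment_angle_quotient_bounds[of w c] by (auto intro: arccos_lbound arccos_ubound)

lemma segment_angle_cnj: "segment_angle c (cnj w) = segment_angle c w"
proof -
  have "norm ((cnj w - of_real c) * cnj (cnj w + of_real c)) = norm ((w - of_real c) * cnj (w + of_real c))"
    using complex_mod_cnj[of "(w - of_real c) * cnj (w + of_real c)"]
    by (simp del: complex_mod_cnj)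
  then show ?thesis by (simp only: segment_angle_def complex_mod_cnj)
qed

lemma continuous_on_segment_angle:
  assumes "of_real c \<notin> S" "- of_real c \<notin> S"
  shows "continuous_on S (segment_angle c)"
  unfolding segment_angle_def
proof (intro continuous_on_arccos continuous_intros ballI conjI segment_angle_quotient_bounds)
  fix w assume "w \<in> S"
  then have "w \<noteq> of_real c" "w \<noteq> - of_real c" using assms by auto
  then have "w - of_real c \<noteq> 0" "cnj (w + of_real c) \<noteq> 0"
    unfolding complex_cnj_zero_iff by (simp_all add: eq_neg_iff_add_eq_0)
  then show "norm ((w - of_real c) * cnj (w + of_real c)) \<noteq> 0"
    by simp
qed

text \<open>The quotient in the definition is the cosine of this argument, and the positive
  imaginary part puts the argument into the range where \<open>arccos\<close> inverts
  \<open>cos\<close>.\<close>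

lemma segment_angle_eq_Arg:
  assumes "0 < c" "0 < Im w"
  shows "segment_angle c w = Arg ((w - of_real c) * cnj (w + of_real c))" (is "_ = Arg ?v")
proof -
  have v: "?v = Complex ((norm w)\<^sup>2 - c\<^sup>2) (2 * c * Im w)" by (rule sub_mult_cnj_add)
  then have Im: "Im ?v > 0" using assms by (simp only: v complex.sel) simp
  then have nz: "?v \<noteq> 0" by (metis less_irrefl zero_complex.simps(2))
  have "cos (Arg ?v) = Re ?v / norm ?v" using cos_Arg[OF nz] by simp
  also have "Re ?v = (norm w)\<^sup>2 - c\<^sup>2" by (simp only: v complex.sel)
  finally have "segment_angle c w = arccos (cos (Arg ?v))" by (simp only: segment_angle_def)
  also have "\<dots> = Arg ?v"
    using Arg_lt_pi[of ?v] Im by (intro arccos_cos) auto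
  finally show ?thesis .
qed

text \<open>The cotangent form of the angle, from which monotonicity along rays can be read
  off.\<close>

lemma segment_angle_eq_arctan:
  assumes c: "0 < c" and y: "Im w \<noteq> 0"
  shows "segment_angle c w = pi / 2 - arctan (((norm w)\<^sup>2 - c\<^sup>2) / (2 * c * \<bar>Im w\<bar>))"
proof -
  define k where "k = 2 * c * \<bar>Im w\<bar>"
  define a where "a = (norm w)\<^sup>2 - c\<^sup>2"
  have k: "k > 0" using assms by (simp add: k_def)
  have "norm ((w - of_real c) * cnj (w + of_real c)) = sqrt (a\<^sup>2 + k\<^sup>2)"
    unfolding sub_mult_cnj_add by (simp add: cmod_def a_def k_def power_mult_distrib)
  also have "a\<^sup>2 + k\<^sup>2 = k\<^sup>2 * (1 + (a / k)\<^sup>2)" using k by (simp add: field_simps)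
  also have "sqrt \<dots> = k * sqrt (1 + (a / k)\<^sup>2)" using k by (simp add: real_sqrt_mult)
  finally have "segment_angle c w = arccos (a / (k * sqrt (1 + (a / k)\<^sup>2)))"
    by (simp add: segment_angle_def a_def)
  also have "\<dots> = arccos (sin (arctan (a / k)))" by (simp add: sin_arctan)
  also have "\<dots> = arccos (cos (pi / 2 - arctan (a / k)))" by (simp add: cos_diff)
  also have "\<dots> = pi / 2 - arctan (a / k)"
    using arctan_bounded[of "a / k"] by (intro arccos_cos) auto
  finally show ?thesis by (simp add: a_def k_def)
qed

text \<open>Along the ray the cotangent has the form \<open>u * A - B / u\<close> with
  \<open>A \<ge> 0\<close> and \<open>B > 0\<close>, which is strictly increasing in
  \<open>u > 0\<close>.\<close>

lemma segment_angle_ray_less: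
  assumes c: "0 < c" and y: "Im w \<noteq> 0" and st: "0 < s" "s < t"
  shows "segment_angle c (t *\<^sub>R w) < segment_angle c (s *\<^sub>R w)"
proof -
  have q: "((norm (u *\<^sub>R w))\<^sup>2 - c\<^sup>2) / (2 * c * \<bar>Im (u *\<^sub>R w)\<bar>)
      = u * ((norm w)\<^sup>2 / (2 * c * \<bar>Im w\<bar>)) - (c / (2 * \<bar>Im w\<bar>)) / u" if "u > 0" for u
    using that c y by (simp add: abs_mult power_mult_distrib field_simps power2_eq_square)
  have "s * ((norm w)\<^sup>2 / (2 * c * \<bar>Im w\<bar>)) \<le> t * ((norm w)\<^sup>2 / (2 * c * \<bar>Im w\<bar>))"
    using st c by (intro mult_right_mono) auto
  moreover have "(c / (2 * \<bar>Im w\<bar>)) / t < (c / (2 * \<bar>Im w\<bar>)) / s"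
    using st c y by (intro divide_strict_left_mono mult_pos_pos[of t]) auto
  ultimately have "((norm (s *\<^sub>R w))\<^sup>2 - c\<^sup>2) / (2 * c * \<bar>Im (s *\<^sub>R w)\<bar>)
      < ((norm (t *\<^sub>R w))\<^sup>2 - c\<^sup>2) / (2 * c * \<bar>Im (t *\<^sub>R w)\<bar>)"
    using st by (simp only: q order_less_trans[of 0 s t])
  moreover have nz: "Im (s *\<^sub>R w) \<noteq> 0" "Im (t *\<^sub>R w) \<noteq> 0" using y st by auto
  ultimately show ?thesis
    unfolding segment_angle_eq_arctan[OF c nz(1)] segment_angle_eq_arctan[OF c nz(2)]
    by (intro diff_strict_left_mono arctan_monotone)
qed

lemma segment_angle_real:
  assumes c: "0 < c" and y: "Im w = 0"
  shows "segment_angle c w = (if norm w < c then pi else if norm w = c then pi / 2 else 0)"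
proof -
  define a where "a = (norm w)\<^sup>2 - c\<^sup>2"
  have "norm ((w - of_real c) * cnj (w + of_real c)) = \<bar>a\<bar>"
    unfolding sub_mult_cnj_add by (simp add: cmod_def a_def y)
  then have eq: "segment_angle c w = arccos (a / \<bar>a\<bar>)" by (simp only: segment_angle_def a_def)
  consider "norm w < c" | "norm w = c" | "c < norm w" by linarith
  then show ?thesis
  proof cases
    case 1
    then have "a < 0" using c by (simp add: a_def power_strict_mono)
    then show ?thesis using 1 by (simp add: eq)
  next
    case 2
    then show ?thesis by (simp add: eq a_def)
  next
    case 3
    then have "a > 0" using c by (simp add: a_def power_strict_mono)
    then show ?thesis using 3 by (simp add: eq)
  qed
qed

text \<open>The real axis is included here; there the decrease is only weak, in steps.\<close>

lemma segment_angle_ray_le: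
  assumes c: "0 < c" and st: "0 < s" "s \<le> t"
  shows "segment_angle c (t *\<^sub>R w) \<le> segment_angle c (s *\<^sub>R w)"
proof (cases "Im w = 0")
  case False
  then show ?thesis using segment_angle_ray_less[OF c False, of s t] st by (cases "s = t") auto
next
  case True
  have "s * norm w \<le> t * norm w" using st by (intro mult_right_mono) auto
  then show ?thesis using st by (auto simp: segment_angle_real[OF c] True)
qed

text \<open>A bound in terms of \<open>norm w\<close> alone, from \<open>\<bar>w\<^sup>2 -
  c\<^sup>2\<bar> \<le> \<bar>w\<bar>\<^sup>2 + c\<^sup>2\<close>; it makes the decay at infinity
  uniform in the direction.\<close>

lemma segment_angle_le:
  assumes c: "0 < c"  and w: "c < norm w"
  shows "segment_angle c w \<le> arccos (((norm w)\<^sup>2 - c\<^sup>2) / ((norm w)\<^sup>2 + c\<^sup>2))"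
proof -
  let ?v = "(w - of_real c) * cnj (w + of_real c)"
  have a: "(norm w)\<^sup>2 - c\<^sup>2 > 0" using assms by (simp add: power_strict_mono)
  have "norm ?v = norm (w - of_real c) * norm (w + of_real c)"
    by (simp only: norm_mult complex_mod_cnj)
  also have "\<dots> = norm (w\<^sup>2 - of_real (c\<^sup>2))"
    unfolding norm_mult[symmetric] by (simp add: power2_eq_square algebra_simps)
  also have "\<dots> \<le> norm (w\<^sup>2) + norm (complex_of_real (c\<^sup>2))" by (rule norm_triangle_ineq4)
  also have "\<dots> = (norm w)\<^sup>2 + c\<^sup>2" by (simp add: norm_power)
  finally have le: "norm ?v \<le> (norm w)\<^sup>2 + c\<^sup>2" .
  have "w \<noteq> of_real c" "w \<noteq> - of_real c" using w c by auto
  then have "norm ?v > 0" by (simp add: eq_neg_iff_add_eq_0 flip: complex_cnj_add)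
  then have "((norm w)\<^sup>2 - c\<^sup>2) / ((norm w)\<^sup>2 + c\<^sup>2) \<le> ((norm w)\<^sup>2 - c\<^sup>2) / norm ?v"
    using le a c w by (intro divide_left_mono mult_pos_pos) (auto intro: add_nonneg_pos)
  then show ?thesis
    unfolding segment_angle_def using segment_angle_quotient_bounds[of w c] a
    by (intro arccos_le_arccos) (auto intro: order_trans[of _ 0])
qed

section \<open>The total angle and its values on the curve\<close>

definition total_angle :: "nat \<Rightarrow> complex \<Rightarrow> real" where
  "total_angle d w = (\<Sum>j<d. segment_angle (half_odd j) w)"

lemma total_angle_nonneg: "0 \<le> total_angle d w"
  by (simp add: total_angle_def sum_nonneg segment_angle_bounds)

lemma total_angle_cnj: "total_angle d (cnj w) = total_angle d w"
  by (simp add: total_angle_def segment_angle_cnj)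

lemma total_angle_ray_le:
  assumes "0 < s" "s \<le> t"
  shows "total_angle d (t *\<^sub>R w) \<le> total_angle d (s *\<^sub>R w)"
  unfolding total_angle_def using assms by (intro sum_mono segment_angle_ray_le) auto

lemma total_angle_ray_less:
  assumes "Im w \<noteq> 0" "0 < s" "s < t" "d \<ge> 1"
  shows "total_angle d (t *\<^sub>R w) < total_angle d (s *\<^sub>R w)"
  unfolding total_angle_def using assms
  by (intro sum_strict_mono segment_angle_ray_less) (auto simp: lessThan_empty_iff)

lemma continuous_on_total_angle:
  assumes "\<And>j. j < d \<Longrightarrow> of_real (half_odd j) \<notin> S" "\<And>j. j < d \<Longrightarrow> - of_real (half_odd j) \<notin> S"
  shows "continuous_on S (total_angle d)"
  unfolding total_angle_def[abs_def] using assms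
  by (intro continuous_on_sum continuous_on_segment_angle) auto

lemma eventually_total_angle_less_pi:
  "\<exists>M. \<forall>w. M \<le> norm w \<longrightarrow> total_angle d w < pi"
proof -
  define g where "g x = (\<Sum>j<d. arccos ((x\<^sup>2 - (half_odd j)\<^sup>2) / (x\<^sup>2 + (half_odd j)\<^sup>2)))" for x
  have "((\<lambda>x. arccos ((x\<^sup>2 - c\<^sup>2) / (x\<^sup>2 + c\<^sup>2))) \<longlongrightarrow> arccos 1) at_top" for c :: real
  proof (rule continuous_on_tendsto_compose[OF continuous_on_arccos'])
    show "((\<lambda>x. (x\<^sup>2 - c\<^sup>2) / (x\<^sup>2 + c\<^sup>2)) \<longlongrightarrow> 1) at_top" by real_asymp
    show "eventually (\<lambda>x. (x\<^sup>2 - c\<^sup>2) / (x\<^sup>2 + c\<^sup>2) \<in> {-1..1}) at_top"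
    proof (rule always_eventually, rule allI)
      fix x :: real
      have "\<bar>x\<^sup>2 - c\<^sup>2\<bar> \<le> x\<^sup>2 + c\<^sup>2" by (simp add: abs_le_iff)
      then have "\<bar>(x\<^sup>2 - c\<^sup>2) / (x\<^sup>2 + c\<^sup>2)\<bar> \<le> 1"
        unfolding abs_divide by (cases "x\<^sup>2 + c\<^sup>2 = 0") (auto simp: divide_le_eq_1 less_le)
      then show "(x\<^sup>2 - c\<^sup>2) / (x\<^sup>2 + c\<^sup>2) \<in> {-1..1}"
        unfolding abs_le_iff atLeastAtMost_iff by linarith
    qed
  qed simp
  then have "(g \<longlongrightarrow> (\<Sum>j<d. arccos 1)) at_top"
    unfolding g_def by (intro tendsto_sum)
  then have "(g \<longlongrightarrow> 0) at_top" by simp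
  then have "eventually (\<lambda>x. g x < pi) at_top" by (rule order_tendstoD) simp
  then obtain M where M: "\<And>x. x \<ge> M \<Longrightarrow> g x < pi" by (auto simp: eventually_at_top_linorder)
  show ?thesis
  proof (intro exI allI impI)
    \<comment> \<open>The second bound places \<open>w\<close> beyond every endpoint, as
      \<open>segment_angle_le\<close> demands.\<close>
    fix w :: complex assume w: "max M (half_odd d) \<le> norm w"
    have "total_angle d w \<le> g (norm w)"
      unfolding total_angle_def g_def
    proof (rule sum_mono)
      fix j assume "j \<in> {..<d}"
      then have "half_odd j < norm w" using w half_odd_less[of j d]
        by (metis lessThan_iff max.bounded_iff order_less_le_trans)
      then show "segment_angle (half_odd j) w
          \<le> arccos (((norm w)\<^sup>2 - (half_odd j)\<^sup>2) / ((norm w)\<^sup>2 + (half_odd j)\<^sup>2))"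
        by (intro segment_angle_le) auto
    qed
    also have "\<dots> < pi" using w M by simp
    finally show "total_angle d w < pi" .
  qed
qed

lemma prod_eq_cis_total_angle:
  assumes "0 < Im w"
  shows "(\<Prod>j<n. (w - of_real (half_odd j)) * cnj (w + of_real (half_odd j)))
    = of_real (\<Prod>j<n. norm ((w - of_real (half_odd j)) * cnj (w + of_real (half_odd j)))) * cis (total_angle n w)"
proof (induction n)
  case (Suc n)
  let ?v = "(w - of_real (half_odd n)) * cnj (w + of_real (half_odd n))"
  have "?v = of_real (norm ?v) * cis (Arg ?v)" using rcis_cmod_Arg[of ?v] by (simp only: rcis_def)
  also have "Arg ?v = segment_angle (half_odd n) w" using assms by (simp only: segment_angle_eq_Arg half_odd_pos)
  finally have v: "?v = of_real (norm ?v) * cis (segment_angle (half_odd n) w)" .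
  have "total_angle (Suc n) w = total_angle n w + segment_angle (half_odd n) w"
    by (simp add: total_angle_def)
  then show ?case unfolding prod.lessThan_Suc Suc.IH
    by (subst v) (simp only: cis_mult[symmetric] of_real_mult mult_ac)
qed (simp add: total_angle_def)

text \<open>In the upper half-plane \<open>Im w * oval_im\<close> is the sine of the total angle
  times a nonzero modulus. The lower half-plane follows by conjugation, since \<open>oval_im\<close>
  is even in \<open>y\<close>.\<close>

lemma curve_iff_sin_total_angle:
  assumes d: "d \<ge> 1" and y: "Im z \<noteq> 0"
  shows "z \<in> curve d \<longleftrightarrow> sin (total_angle d (z + 1 / 2)) = 0"
proof -
  have pos: "z \<in> curve d \<longleftrightarrow> sin (total_angle d (z + 1 / 2)) = 0" if y: "Im z > 0" for z
  proof -
    define w where "w = z + 1 / 2"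
    have w: "Im w = Im z" by (simp add: w_def)
    define R where "R = (\<Prod>j<d. norm ((w - of_real (half_odd j)) * cnj (w + of_real (half_odd j))))"
    have "w - of_real (half_odd j) \<noteq> 0" "cnj (w + of_real (half_odd j)) \<noteq> 0" for j
      unfolding complex_cnj_zero_iff using y w by (auto simp: complex_eq_iff)
    then have "R \<noteq> 0" unfolding R_def by (simp only: prod_zero_iff finite_lessThan norm_eq_zero mult_eq_0_iff) blast
    have "Complex (oval_re d ((norm w)\<^sup>2) (Im w)) (Im w * oval_im d ((norm w)\<^sup>2) (Im w))
        = of_real R * cis (total_angle d w)"
      unfolding prod_sub_mult_cnj_add[symmetric] R_def using y w by (intro prod_eq_cis_total_angle) simp
    then have "Im w * oval_im d ((norm w)\<^sup>2) (Im w) = R * sin (total_angle d w)"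
      by (simp add: complex_eq_iff)
    then have "oval_im d ((norm w)\<^sup>2) (Im w) = 0 \<longleftrightarrow> sin (total_angle d w) = 0"
      using y w \<open>R \<noteq> 0\<close> by (metis less_irrefl mult_eq_0_iff)
    then show ?thesis using w by (simp add: curve_eq_oval_im[OF d] w_def)
  qed
  have even: "oval_re n t (- y) = oval_re n t y \<and> oval_im n t (- y) = oval_im n t y" for n t y
    by (induction n) auto
  have cnj: "cnj z + 1 / 2 = cnj (z + 1 / 2)" by (simp add: complex_eq_iff)
  have "z \<in> curve d \<longleftrightarrow> cnj z \<in> curve d"
    using even by (simp only: curve_eq_oval_im[OF d] mem_Collect_eq cnj complex_mod_cnj cnj.sel)
  moreover have "total_angle d (cnj z + 1 / 2) = total_angle d (z + 1 / 2)"
    unfolding cnj by (rule total_angle_cnj)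
  ultimately show ?thesis using pos[of z] pos[of "cnj z"] y by (cases "Im z > 0") simp_all
qed

lemma real_norm_half_odd:
  assumes "Im w = 0" "norm w = half_odd j"
  shows "w = of_real (half_odd j) \<or> w = - of_real (half_odd j)"
  using assms by (auto simp: cmod_def complex_eq_iff abs_eq_iff split: abs_split)

text \<open>Keeps the curve away from the segment endpoints, so that the total angle is continuous
  on it.\<close>

lemma curve_not_half_odd:
  assumes z: "z \<in> curve d" and d: "d \<ge> 1" and j: "j < d"
  shows "z + 1 / 2 \<noteq> of_real (half_odd j)" "z + 1 / 2 \<noteq> - of_real (half_odd j)"
proof -
  have ne: "z + 1 / 2 \<noteq> of_real s" if s: "\<bar>s\<bar> = half_odd j" for s
  proof
    assume w: "z + 1 / 2 = of_real s"
    have "Im (z + 1 / 2) = 0" unfolding w by simp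
    then have "Im z = 0" by simp
    moreover have "norm (z + 1 / 2) = half_odd j" unfolding w using s by simp
    ultimately show False
      using z oval_im_real_half_odd[OF j] by (simp add: curve_eq_oval_im[OF d])
  qed
  from ne[of "half_odd j"] ne[of "- half_odd j"]
  show "z + 1 / 2 \<noteq> of_real (half_odd j)" "z + 1 / 2 \<noteq> - of_real (half_odd j)"
    by (simp_all add: less_imp_le)
qed

lemma continuous_on_total_angle_curve:
  assumes "d \<ge> 1"
  shows "continuous_on (curve d) (\<lambda>z. total_angle d (z + 1 / 2))"
proof (rule continuous_on_compose2[where g = "total_angle d"])
  show "continuous_on ((\<lambda>z. z + 1 / 2) ` curve d) (total_angle d)"
    using curve_not_half_odd[OF _ assms] by (intro continuous_on_total_angle) force+
qed (auto intro!: continuous_intros)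

lemma total_angle_real:
  assumes "Im w = 0" "\<And>j. j < d \<Longrightarrow> norm w \<noteq> half_odd j"
  shows "total_angle d w = real (card {j. j < d \<and> norm w < half_odd j}) * pi"
proof -
  have "total_angle d w = (\<Sum>j<d. if norm w < half_odd j then pi else 0)"
    unfolding total_angle_def using assms by (intro sum.cong) (auto simp: segment_angle_real)
  also have "\<dots> = real (card {j. j < d \<and> norm w < half_odd j}) * pi"
    by (simp add: sum.If_cases Int_def)
  finally show ?thesis .
qed

text \<open>Off the real axis the multiple comes from the zeros of the sine. On it, the angle counts
  the segments containing the point, and beyond all segments \<open>oval_im\<close> is positive, so
  the count is not zero.\<close>

lemma total_angle_curve:
  assumes z: "z \<in> curve d" and d: "d \<ge> 1"
  shows "\<exists>k::nat. k \<ge> 1 \<and> total_angle d (z + 1 / 2) = real k * pi"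
proof (cases "Im z = 0")
  case False
  then have "sin (total_angle d (z + 1 / 2)) = 0" using z d by (simp add: curve_iff_sin_total_angle)
  then obtain i :: int where i: "total_angle d (z + 1 / 2) = of_int i * pi" by (auto simp: sin_zero_iff_int2)
  have w: "Im (z + 1 / 2) \<noteq> 0" using False by simp
  \<comment> \<open>Comparison with a point further out on the ray shows that the angle is strictly
    positive, which excludes the multiple \<open>0\<close>.\<close>
  have "0 \<le> total_angle d (2 *\<^sub>R (z + 1 / 2))" by (rule total_angle_nonneg)
  also have "\<dots> < total_angle d (1 *\<^sub>R (z + 1 / 2))" using w d by (intro total_angle_ray_less) auto
  finally have "i \<ge> 1" using i by (simp add: zero_less_mult_iff)
  then show ?thesis using i by (intro exI[where x = "nat i"]) auto
next
  case True
  define w where "w = z + 1 / 2"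
  have w: "Im w = 0" using True by (simp add: w_def)
  have ne: "norm w \<noteq> half_odd j" if "j < d" for j
    using real_norm_half_odd[OF w, of j] curve_not_half_odd[OF z d that] by (auto simp: w_def)
  have "\<exists>j<d. norm w < half_odd j"
  proof (rule ccontr)
    assume "\<not> ?thesis"
    then have "half_odd j < norm w" if "j < d" for j using ne[OF that] that by force
    then have "(half_odd j)\<^sup>2 < (norm w)\<^sup>2" if "j < d" for j
      using that by (intro power_strict_mono) (auto simp: less_imp_le)
    then have "oval_im d ((norm w)\<^sup>2) 0 > 0" using d by (rule oval_im_real_pos)
    then show False using z True by (simp add: curve_eq_oval_im[OF d] w_def)
  qed
  then have "card {j. j < d \<and> norm w < half_odd j} \<noteq> 0" by (auto simp: card_eq_0_iff)
  then show ?thesis using total_angle_real[OF w ne, of d] unfolding w_def[symmetric]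
    by (intro exI[where x = "card {j. j < d \<and> norm w < half_odd j}"] conjI) linarith+
qed

section \<open>The outermost oval\<close>

text \<open>Membership in \<open>curve d\<close> is required because on the real axis the total
  angle equals \<open>pi\<close> on whole intervals.\<close>

definition outer_curve :: "nat \<Rightarrow> complex set" where
  "outer_curve d = {z \<in> curve d. total_angle d (z + 1 / 2) = pi}"

lemma outer_curve_nonreal:
  assumes "d \<ge> 1" "Im z \<noteq> 0"
  shows "z \<in> outer_curve d \<longleftrightarrow> total_angle d (z + 1 / 2) = pi"
  using assms by (auto simp: outer_curve_def curve_iff_sin_total_angle)

text \<open>A real point off the endpoints has total angle \<open>pi\<close> exactly when it lies in
  the longest segment only, that is, in the gap between the last two endpoints.\<close>

lemma outer_curve_real:
  fixes n :: nat
  defines "d \<equiv> Suc (Suc n)"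
  assumes y: "Im z = 0"
  shows "z \<in> outer_curve d \<longleftrightarrow>
    half_odd n < norm (z + 1 / 2) \<and> norm (z + 1 / 2) < half_odd (Suc n) \<and> oval_im d ((norm (z + 1 / 2))\<^sup>2) 0 = 0"
proof
  have d: "d \<ge> 1" by (simp add: d_def)
  have w: "Im (z + 1 / 2) = 0" using y by simp
  {
    assume z: "z \<in> outer_curve d"
    then have zc: "z \<in> curve d" by (simp add: outer_curve_def)
    have ne: "norm (z + 1 / 2) \<noteq> half_odd j" if "j < d" for j
      using real_norm_half_odd[OF w, of j] curve_not_half_odd[OF zc d that] by auto
    let ?S = "{j. j < d \<and> norm (z + 1 / 2) < half_odd j}"
    have "real (card ?S) * pi = pi"
      using total_angle_real[OF w ne] z by (simp add: outer_curve_def)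
    then have card: "card ?S = 1" by simp
    have "norm (z + 1 / 2) < half_odd (Suc n)"
    proof (rule ccontr)
      assume "\<not> ?thesis"
      then have "\<not> norm (z + 1 / 2) < half_odd j" if "j < d" for j
        using that by (auto simp: d_def half_odd_def)
      then have "?S = {}" by auto
      then show False using card by (simp only: card.empty)
    qed
    moreover have "half_odd n < norm (z + 1 / 2)"
    proof (rule ccontr)
      assume "\<not> ?thesis"
      then have "norm (z + 1 / 2) < half_odd n" using ne[of n] by (simp add: d_def)
      then have "{n, Suc n} \<subseteq> ?S" by (auto simp: d_def half_odd_def)
      then have "card {n, Suc n} \<le> card ?S" by (intro card_mono) auto
      then show False using card by simp
    qed
    moreover have "oval_im d ((norm (z + 1 / 2))\<^sup>2) 0 = 0"
      using zc y by (simp add: curve_eq_oval_im[OF d])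
    ultimately show "half_odd n < norm (z + 1 / 2) \<and> norm (z + 1 / 2) < half_odd (Suc n)
      \<and> oval_im d ((norm (z + 1 / 2))\<^sup>2) 0 = 0" by simp
  next
    assume r: "half_odd n < norm (z + 1 / 2) \<and> norm (z + 1 / 2) < half_odd (Suc n)
      \<and> oval_im d ((norm (z + 1 / 2))\<^sup>2) 0 = 0"
    have j: "norm (z + 1 / 2) \<noteq> half_odd j \<and> (norm (z + 1 / 2) < half_odd j \<longleftrightarrow> j = Suc n)" if "j < d" for j
    proof (cases "j \<le> n")
      case True
      then have "half_odd j \<le> half_odd n" by (simp add: half_odd_def)
      then show ?thesis using r True by auto
    next
      case False
      then show ?thesis using r that by (simp add: d_def less_Suc_eq)
    qed
    have ne: "norm (z + 1 / 2) \<noteq> half_odd j" if "j < d" for j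
      using j[OF that] by simp
    have S: "{j. j < d \<and> norm (z + 1 / 2) < half_odd j} = {Suc n}"
      using j by (auto simp: d_def)
    have "total_angle d (z + 1 / 2) = pi" using total_angle_real[OF w ne] S by simp
    then show "z \<in> outer_curve d"
      using r y by (simp add: outer_curve_def curve_eq_oval_im[OF d])
  }
qed

text \<open>For a non-real direction the angle falls continuously and strictly from above
  \<open>pi\<close> to below \<open>pi\<close>. For a real direction the unique root of
  \<open>oval_im\<close> in the last gap gives the point.\<close>

lemma outer_curve_ray:
  assumes d: "d \<ge> 2" and w: "w \<noteq> 0"
  shows "\<exists>!s. 0 < s \<and> - 1 / 2 + s *\<^sub>R w \<in> outer_curve d"
proof (cases "Im w = 0")
  case False
  have mem: "- 1 / 2 + s *\<^sub>R w \<in> outer_curve d \<longleftrightarrow> total_angle d (s *\<^sub>R w) = pi" if "s > 0" for s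
    using outer_curve_nonreal[of d "- 1 / 2 + s *\<^sub>R w"] that False d by simp
  obtain M where M: "\<And>v. M \<le> norm v \<Longrightarrow> total_angle d v < pi"
    using eventually_total_angle_less_pi[of d] by blast
  define N where "N = max 1 (M / norm w)"
  have N: "N \<ge> 0" "total_angle d (N *\<^sub>R w) < pi"
  proof -
    have "M \<le> norm (N *\<^sub>R w)" using w by (simp add: N_def pos_divide_le_eq[symmetric])
    then show "total_angle d (N *\<^sub>R w) < pi" by (rule M)
  qed (simp add: N_def)
  have ne: "s *\<^sub>R w \<noteq> of_real (half_odd j)" "s *\<^sub>R w \<noteq> - of_real (half_odd j)" for s j
    using False half_odd_pos[of j, THEN less_imp_neq] by (auto simp: complex_eq_iff)
  have "continuous_on {0..N} (\<lambda>s. total_angle d (s *\<^sub>R w))"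
  proof (rule continuous_on_compose2[where g = "total_angle d"])
    show "continuous_on (range (\<lambda>s. s *\<^sub>R w)) (total_angle d)"
      using ne by (intro continuous_on_total_angle) (metis imageE)+
  qed (auto intro!: continuous_intros)
  \<comment> \<open>The centre lies inside every segment, so the angle starts at
    \<open>d * pi\<close>, which exceeds \<open>pi\<close> because \<open>d \<ge> 2\<close>.\<close>
  moreover have "segment_angle (half_odd j) 0 = pi" for j
    by (simp add: segment_angle_real)
  then have "total_angle d 0 = real d * pi" by (simp add: total_angle_def)
  then have "pi < total_angle d (0 *\<^sub>R w)" using d by simp
  ultimately obtain s where s: "0 \<le> s" "s \<le> N" "total_angle d (s *\<^sub>R w) = pi"
    using IVT2'[of "\<lambda>s. total_angle d (s *\<^sub>R w)" N pi 0] N by (auto intro: less_imp_le)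
  then have "s \<noteq> 0" using \<open>pi < total_angle d (0 *\<^sub>R w)\<close> by auto
  then have "0 < s \<and> - 1 / 2 + s *\<^sub>R w \<in> outer_curve d" using s mem[of s] by simp
  moreover have "s = t" if "0 < s \<and> - 1 / 2 + s *\<^sub>R w \<in> outer_curve d"
      "0 < t \<and> - 1 / 2 + t *\<^sub>R w \<in> outer_curve d" for s t
    using total_angle_ray_less[OF False, of s t d] total_angle_ray_less[OF False, of t s d] that mem d
    by (metis One_nat_def Suc_1 Suc_leD less_irrefl linorder_neqE)
  ultimately show ?thesis by blast
next
  case True
  obtain n where n: "d = Suc (Suc n)" using le_Suc_ex[OF d] by auto
  let ?P = "\<lambda>t. (half_odd n)\<^sup>2 < t \<and> t < (half_odd (Suc n))\<^sup>2 \<and> oval_im (Suc (Suc n)) t 0 = 0"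
  have mem: "- 1 / 2 + s *\<^sub>R w \<in> outer_curve d \<longleftrightarrow> ?P ((s * norm w)\<^sup>2)" if "s > 0" for s
  proof -
    have "half_odd n < s * norm w \<longleftrightarrow> (half_odd n)\<^sup>2 < (s * norm w)\<^sup>2"
      "s * norm w < half_odd (Suc n) \<longleftrightarrow> (s * norm w)\<^sup>2 < (half_odd (Suc n))\<^sup>2"
      using that half_odd_pos[of n] half_odd_pos[of "Suc n"]
      by (auto intro: power_strict_mono power_less_imp_less_base simp: less_imp_le)
    then show ?thesis
      using outer_curve_real[of "- 1 / 2 + s *\<^sub>R w" n] that True by (simp add: n del: oval_im.simps)
  qed
  obtain t where t: "?P t" and uniq: "\<And>u. ?P u \<Longrightarrow> u = t"
    using oval_im_real_root[of n] by blast
  have t0: "t > 0" using t by (meson le_less_trans zero_le_power2)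
  \<comment> \<open>The root \<open>t\<close> prescribes the squared modulus of the point, hence
    this scaling factor.\<close>
  have "0 < sqrt t / norm w \<and> - 1 / 2 + (sqrt t / norm w) *\<^sub>R w \<in> outer_curve d"
    using mem[of "sqrt t / norm w"] t0 t w by simp
  moreover have "s = sqrt t / norm w" if "0 < s \<and> - 1 / 2 + s *\<^sub>R w \<in> outer_curve d" for s
  proof -
    have "(s * norm w)\<^sup>2 = t" using that mem[of s] uniq by blast
    then have "s * norm w = sqrt t" using that by (auto simp: real_sqrt_unique)
    then show ?thesis using w by (simp add: field_simps)
  qed
  ultimately show ?thesis by blast
qed

lemma compact_outer_curve:
  assumes d: "d \<ge> 1"
  shows "compact (outer_curve d)"
proof -
  have "outer_curve d = curve d \<inter> (\<lambda>z. total_angle d (z + 1 / 2)) -` {pi}"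
    by (auto simp: outer_curve_def)
  then have "closed (outer_curve d)"
    using continuous_closed_preimage[OF continuous_on_total_angle_curve[OF d] closed_curve[OF d] closed_singleton]
    by simp
  moreover obtain M where M: "\<And>v. M \<le> norm v \<Longrightarrow> total_angle d v < pi"
    using eventually_total_angle_less_pi[of d] by blast
  have "outer_curve d \<subseteq> cball (- 1 / 2) M"
  proof
    fix z assume "z \<in> outer_curve d"
    then have "\<not> M \<le> norm (z + 1 / 2)" using M[of "z + 1 / 2"] by (auto simp: outer_curve_def)
    then show "z \<in> cball (- 1 / 2) M" unfolding mem_cball dist_commute[of "- 1 / 2"] by (simp add: dist_norm)
  qed
  then have "bounded (outer_curve d)" using bounded_cball bounded_subset by blast
  ultimately show ?thesis by (simp add: compact_eq_bounded_closed)
qed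

lemma center_not_outer_curve:
  assumes d: "d \<ge> 2"
  shows "- 1 / 2 \<notin> outer_curve d"
proof -
  obtain n where n: "d = Suc (Suc n)" using le_Suc_ex[OF d] by auto
  show ?thesis using outer_curve_real[of "- 1 / 2" n] half_odd_pos[of n] by (simp add: n)
qed

lemma outer_curve_homeomorphic:
  assumes "d \<ge> 2"
  shows "outer_curve d homeomorphic sphere (0 :: complex) 1"
  using assms by (intro radial_curve_homeomorphic[where a = "- 1 / 2"] compact_outer_curve center_not_outer_curve
      outer_curve_ray) auto

lemma inside_outer_curve:
  assumes "d \<ge> 2"
  shows "inside (outer_curve d)
    = insert (- 1 / 2) {z. \<exists>s>1. - 1 / 2 + s *\<^sub>R (z - (- 1 / 2)) \<in> outer_curve d}"
  using assms by (intro radial_curve_inside compact_outer_curve center_not_outer_curve outer_curve_ray) auto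

text \<open>Connectedness is inherited from the circle; for maximality, the level \<open>pi\<close>
  is isolated among the values of the total angle on the curve.\<close>

lemma outer_curve_component:
  assumes d: "d \<ge> 2"
  shows "outer_curve d \<in> components (curve d)"
proof -
  have d1: "d \<ge> 1" using d by simp
  have ne: "outer_curve d \<noteq> {}" using outer_curve_ray[OF d, of 1] by auto
  have "connected (sphere (0 :: complex) 1)" by (rule connected_sphere) simp
  then have conn: "connected (outer_curve d)"
    using homeomorphic_connectedness[OF outer_curve_homeomorphic[OF d]] by blast
  have maximal: "X = outer_curve d" if X: "outer_curve d \<subseteq> X" "X \<subseteq> curve d" "connected X" for X
  proof -
    \<comment> \<open>On the curve the total angle is continuous with values in the multiples of \<open>\<pi>\<close>.\<close>
    have "(\<lambda>z. total_angle d (z + 1 / 2)) constant_on X"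
    proof (rule continuous_discrete_range_constant[OF X(3)])
      show "continuous_on X (\<lambda>z. total_angle d (z + 1 / 2))"
        using continuous_on_total_angle_curve[OF d1] X(2) by (rule continuous_on_subset)
      fix x assume x: "x \<in> X"
      show "\<exists>e>0. \<forall>y. y \<in> X \<and> total_angle d (y + 1 / 2) \<noteq> total_angle d (x + 1 / 2) \<longrightarrow>
          e \<le> norm (total_angle d (y + 1 / 2) - total_angle d (x + 1 / 2))"
      proof (intro exI[where x = pi] conjI allI impI)
        fix y assume y: "y \<in> X \<and> total_angle d (y + 1 / 2) \<noteq> total_angle d (x + 1 / 2)"
        obtain k l :: nat where k: "total_angle d (x + 1 / 2) = real k * pi"
          and l: "total_angle d (y + 1 / 2) = real l * pi"
          using total_angle_curve[OF _ d1] x y X(2) by (meson subsetD)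
        then have "k \<noteq> l" using y by auto
        then have "1 \<le> \<bar>real l - real k\<bar>" by linarith
        then have "pi \<le> \<bar>real l - real k\<bar> * pi" by (simp add: mult_le_cancel_right1)
        then show "pi \<le> norm (total_angle d (y + 1 / 2) - total_angle d (x + 1 / 2))"
          unfolding k l by (simp add: abs_mult flip: left_diff_distrib)
      qed simp
    qed
    then obtain c where "\<And>z. z \<in> X \<Longrightarrow> total_angle d (z + 1 / 2) = c" by (auto simp: constant_on_def)
    moreover obtain z where "z \<in> outer_curve d" using ne by auto
    ultimately have "\<And>z. z \<in> X \<Longrightarrow> total_angle d (z + 1 / 2) = pi" using X(1) by (auto simp: outer_curve_def)
    then show ?thesis using X by (auto simp: outer_curve_def)
  qed
  show ?thesis unfolding in_components_maximal
    using ne conn maximal by (auto simp: outer_curve_def)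
qed

text \<open>The other points of the curve have a total angle of at least \<open>2 * pi\<close>, and
  the angle decreases outwards, so the level \<open>pi\<close> is met further out on their
  ray.\<close>

lemma curve_subset_inside_outer_curve:
  assumes d: "d \<ge> 2" and z: "z \<in> curve d" "z \<notin> outer_curve d"
  shows "z \<in> inside (outer_curve d)"
proof (cases "z = - 1 / 2")
  case False
  define w where "w = z + 1 / 2"
  have "w \<noteq> 0" using False using eq_neg_iff_add_eq_0[of z "1 / 2"] by (simp add: w_def)
  then obtain s where s: "s > 0" "- 1 / 2 + s *\<^sub>R w \<in> outer_curve d" using outer_curve_ray[OF d] by blast
  obtain k :: nat where k: "k \<ge> 1" "total_angle d w = real k * pi"
    using total_angle_curve[OF z(1)] d unfolding w_def by auto
  have "s > 1"
  proof (rule ccontr)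
    assume "\<not> s > 1"
    then have "total_angle d (1 *\<^sub>R w) \<le> total_angle d (s *\<^sub>R w)" using s by (intro total_angle_ray_le) auto
    also have "\<dots> = pi" using s(2) by (simp add: outer_curve_def)
    finally have "total_angle d w = pi" using k by simp
    then show False using z by (simp add: outer_curve_def w_def)
  qed
  then show ?thesis using s by (auto simp: inside_outer_curve[OF d] w_def)
qed (simp add: inside_outer_curve[OF d])

lemma outermost_oval_eq:
  assumes d: "d \<ge> 2"
  shows "outermost_oval d = outer_curve d"
  unfolding outermost_oval_def
proof (rule the_equality)
  have oval: "is_oval d (outer_curve d)"
    using outer_curve_component[OF d] outer_curve_homeomorphic[OF d] by (simp add: is_oval_def)
  moreover have ins: "C' \<subseteq> inside (outer_curve d)" if "is_oval d C'" "C' \<noteq> outer_curve d" for C'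
  proof -
    have C': "C' \<in> components (curve d)" using that by (simp add: is_oval_def)
    then have "C' \<inter> outer_curve d = {}"
      using components_nonoverlap[OF C' outer_curve_component[OF d]] that by simp
    then show ?thesis
      using curve_subset_inside_outer_curve[OF d] in_components_subset[OF C'] by blast
  qed
  ultimately show "is_oval d (outer_curve d) \<and>
      (\<forall>C'. is_oval d C' \<and> C' \<noteq> outer_curve d \<longrightarrow> C' \<subseteq> inside (outer_curve d))"
    by blast
  \<comment> \<open>A second outermost oval and \<open>outer_curve d\<close> would each lie inside
    the other; nesting of insides then puts \<open>outer_curve d\<close> inside itself.\<close>
  fix C assume C: "is_oval d C \<and> (\<forall>C'. is_oval d C' \<and> C' \<noteq> C \<longrightarrow> C' \<subseteq> inside C)"
  show "C = outer_curve d"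
  proof (rule ccontr)
    assume ne: "C \<noteq> outer_curve d"
    then have "outer_curve d \<subseteq> inside C" "C \<subseteq> inside (outer_curve d)" using C oval ins by auto
    have "compact C"
      using C homeomorphic_compactness[of C "sphere (0 :: complex) 1"] by (simp add: is_oval_def)
    moreover have "connected (outer_curve d)"
      using outer_curve_component[OF d] by (rule in_components_connected)
    ultimately have "inside C \<subseteq> inside (outer_curve d)"
      using \<open>C \<subseteq> inside (outer_curve d)\<close> compact_outer_curve[of d] d
      by (intro inside_inside_compact_connected) (auto intro: compact_imp_closed)
    then have "outer_curve d \<subseteq> inside (outer_curve d)"
      using \<open>outer_curve d \<subseteq> inside C\<close> by blast
    then show False
      using inside_no_overlap[of "outer_curve d"] in_components_nonempty[OF outer_curve_component[OF d]] by blast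
  qed
qed

section \<open>Nonnegative combinations of the shifted products\<close>

text \<open>For \<open>Im z > 0\<close> this is the argument of \<open>z + t\<close>, as an
  arccotangent so that it is visibly decreasing in \<open>t\<close>.\<close>

definition shift_arg :: "complex \<Rightarrow> real \<Rightarrow> real" where
  "shift_arg z t = pi / 2 - arctan ((Re z + t) / Im z)"

lemma shift_arg_bounds: "0 < shift_arg z t" "shift_arg z t < pi"
  using arctan_bounded[of "(Re z + t) / Im z"] by (auto simp: shift_arg_def)

lemma shift_arg_less:
  assumes "Im z > 0" "s < t"
  shows "shift_arg z t < shift_arg z s"
  using assms by (simp add: shift_arg_def arctan_less_iff divide_strict_right_mono)

lemma add_of_real_eq_cis:
  assumes y: "Im z > 0"
  shows "z + of_real t = of_real (norm (z + of_real t)) * cis (shift_arg z t)"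
proof -
  define q where "q = (Re z + t) / Im z"
  have q: "Re z + t = q * Im z" using y by (simp add: q_def)
  have "norm (z + of_real t) = sqrt ((Im z)\<^sup>2 * (1 + q\<^sup>2))"
    by (simp add: cmod_def q power_mult_distrib distrib_left mult.commute)
  also have "\<dots> = Im z * sqrt (1 + q\<^sup>2)" using y by (simp add: real_sqrt_mult)
  finally have n: "norm (z + of_real t) = Im z * sqrt (1 + q\<^sup>2)" .
  have "1 + q\<^sup>2 > 0" by (intro add_pos_nonneg) auto
  then have "sqrt (1 + q\<^sup>2) \<noteq> 0" by simp
  moreover have "cos (shift_arg z t) = q / sqrt (1 + q\<^sup>2)" "sin (shift_arg z t) = 1 / sqrt (1 + q\<^sup>2)"
    by (simp_all add: shift_arg_def q_def[symmetric] cos_diff sin_diff sin_arctan cos_arctan)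
  ultimately show ?thesis
    unfolding n by (simp add: complex_eq_iff q)
qed

text \<open>An argument of \<open>shifted_prod d k z\<close> that is not reduced modulo
  \<open>2 * pi\<close>, so that differences record the full turning.\<close>

definition prod_arg :: "nat \<Rightarrow> nat \<Rightarrow> complex \<Rightarrow> real" where
  "prod_arg d k z = (\<Sum>i<d. shift_arg z (real d - real k - real i))"

lemma shifted_prod_eq_cis:
  assumes y: "Im z > 0"
  shows "shifted_prod d k z = of_real (norm (shifted_prod d k z)) * cis (prod_arg d k z)"
proof -
  have "(\<Prod>i<n. z + of_real (t i)) = of_real (\<Prod>i<n. norm (z + of_real (t i))) * cis (\<Sum>i<n. shift_arg z (t i))"
    for n :: nat and t
  proof (induction n)
    case (Suc n)
    then show ?case
      using add_of_real_eq_cis[OF y, of "t n"] by (simp add: mult_ac flip: cis_mult)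
  qed simp
  note this[of "\<lambda>i. real d - real k - real i" d]
  moreover have "shifted_prod d k z = (\<Prod>i<d. z + of_real (real d - real k - real i))"
    by (simp add: shifted_prod_def algebra_simps)
  ultimately show ?thesis by (simp only: prod_norm prod_arg_def)
qed

text \<open>Consecutive products differ in their end factors only. The increment is the angle under
  which the segment from \<open>k - d\<close> to \<open>k\<close> is seen from
  \<open>z\<close>.\<close>

lemma prod_arg_Suc:
  "prod_arg d (Suc k) z - prod_arg d k z = shift_arg z (- real k) - shift_arg z (real d - real k)"
proof -
  have "prod_arg d (Suc k) z - prod_arg d k z
      = (\<Sum>i<d. shift_arg z (real d - real k - real (Suc i)) - shift_arg z (real d - real k - real i))"
    by (simp add: prod_arg_def sum_subtractf algebra_simps)
  also have "\<dots> = shift_arg z (- real k) - shift_arg z (real d - real k)"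
    by (subst sum_lessThan_telescope) simp
  finally show ?thesis .
qed

lemma prod_arg_increment:
  assumes "Im z > 0" "d \<ge> 1"
  shows "prod_arg d k z < prod_arg d (Suc k) z" "prod_arg d (Suc k) z < prod_arg d k z + pi"
proof -
  have "shift_arg z (real d - real k) < shift_arg z (- real k)"
    using assms by (intro shift_arg_less) auto
  then show "prod_arg d k z < prod_arg d (Suc k) z" "prod_arg d (Suc k) z < prod_arg d k z + pi"
    using prod_arg_Suc[of d k z] shift_arg_bounds[of z "- real k"] shift_arg_bounds[of z "real d - real k"]
    by linarith+
qed

text \<open>In terms of \<open>z\<close> the endpoints \<open>half_odd j\<close> and
  \<open>- half_odd j\<close> become \<open>j\<close> and \<open>- (j + 1)\<close>; the angle is a
  difference of two arguments.\<close>

lemma segment_angle_eq_shift_arg: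
  assumes y: "Im z > 0"
  shows "segment_angle (half_odd j) (z + 1 / 2) = shift_arg z (- real j) - shift_arg z (real (Suc j))"
proof -
  let ?a = "z + of_real (- real j)" and ?b = "z + of_real (real (Suc j))"
  let ?x = "shift_arg z (- real j) - shift_arg z (real (Suc j))"
  have nz: "?a \<noteq> 0" "?b \<noteq> 0" using y by (auto simp: complex_eq_iff)
  have "?a * cnj ?b = (of_real (norm ?a) * cis (shift_arg z (- real j)))
      * cnj (of_real (norm ?b) * cis (shift_arg z (real (Suc j))))"
    by (intro arg_cong2[where f = "\<lambda>u v. u * cnj v"] add_of_real_eq_cis y)
  also have "\<dots> = of_real (norm ?a * norm ?b) * cis ?x"
    unfolding complex_cnj_mult cis_cnj by (simp add: mult_ac flip: cis_divide) (simp add: cis_mult divide_inverse cis_inverse)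
  finally have "?a * cnj ?b = of_real (norm ?a * norm ?b) * cis ?x" .
  moreover have "?a * cnj ?b = (z + 1 / 2 - of_real (half_odd j)) * cnj (z + 1 / 2 + of_real (half_odd j))"
    by (simp add: half_odd_def)
  ultimately have v: "(z + 1 / 2 - of_real (half_odd j)) * cnj (z + 1 / 2 + of_real (half_odd j))
      = of_real (norm ?a * norm ?b) * cis ?x" by simp
  have "shift_arg z (real (Suc j)) < shift_arg z (- real j)" using y by (intro shift_arg_less) auto
  then have x: "- pi < ?x" "?x \<le> pi"
    using shift_arg_bounds[of z "- real j"] shift_arg_bounds[of z "real (Suc j)"] by linarith+
  have "Arg (of_real (norm ?a * norm ?b) * cis ?x) = ?x"
  proof (rule cis_Arg_unique)
    show "sgn (of_real (norm ?a * norm ?b) * cis ?x) = cis ?x"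
      using nz by (simp add: sgn_mult sgn_of_real)
  qed (use x in auto)
  then show ?thesis
    using y by (subst segment_angle_eq_Arg) (simp_all only: v half_odd_pos, simp)
qed

lemma total_angle_eq_prod_arg:
  assumes y: "Im z > 0"
  shows "total_angle d (z + 1 / 2) = prod_arg d d z - prod_arg d 0 z"
proof -
  have "prod_arg d 0 z = (\<Sum>i<d. shift_arg z (real d - real (d - Suc i)))"
    unfolding prod_arg_def by (subst sum.nat_diff_reindex[symmetric]) simp
  also have "\<dots> = (\<Sum>i<d. shift_arg z (real (Suc i)))"
    by (intro sum.cong) (auto simp: of_nat_diff)
  finally show ?thesis
    by (simp add: total_angle_def segment_angle_eq_shift_arg[OF y] prod_arg_def sum_subtractf)
qed

section \<open>When zero is a nonnegative combination: non-real points\<close>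

lemma cross_shifted_prod:
  assumes y: "Im z > 0"
  shows "cross (shifted_prod d j z) (shifted_prod d k z)
    = norm (shifted_prod d j z) * norm (shifted_prod d k z) * sin (prod_arg d k z - prod_arg d j z)"
proof -
  have "cnj (of_real r * cis a) * (of_real s * cis b) = of_real (r * s) * cis (b - a)" for r s a b
  proof -
    have "cnj (of_real r * cis a) * (of_real s * cis b) = of_real (r * s) * (cis (- a) * cis b)"
      by (simp add: cis_cnj)
    then show ?thesis by (simp only: cis_mult uminus_add_conv_diff)
  qed
  then have "cnj (shifted_prod d j z) * shifted_prod d k z
      = of_real (norm (shifted_prod d j z) * norm (shifted_prod d k z)) * cis (prod_arg d k z - prod_arg d j z)"
    using arg_cong2[OF shifted_prod_eq_cis[OF y, of d j] shifted_prod_eq_cis[OF y, of d k],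
        of "\<lambda>u v. cnj u * v"] by (simp only:)
  then show ?thesis by (simp add: cross_def)
qed

lemma prod_arg_mono:
  assumes "Im z > 0" "d \<ge> 1" "j \<le> k"
  shows "prod_arg d j z \<le> prod_arg d k z"
  by (rule lift_Suc_mono_le[where f = "\<lambda>k. prod_arg d k z",
        OF less_imp_le[OF prod_arg_increment(1)[OF assms(1,2)]] assms(3)])

text \<open>All products with positive index lie strictly to the left of the line through
  \<open>0\<close> and \<open>shifted_prod d 0 z\<close>. Taking \<open>cross\<close> with that
  vector forces their coefficients to vanish, and then the first one vanishes too.\<close>

lemma no_root_if_total_angle_less:
  fixes a :: "nat \<Rightarrow> real"
  assumes y: "Im z > 0" and d: "d \<ge> 1" and angle: "total_angle d (z + 1 / 2) < pi"
    and a: "\<And>j. j \<le> d \<Longrightarrow> 0 \<le> a j" and sum: "(\<Sum>j\<le>d. of_real (a j) * shifted_prod d j z) = 0"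
    and j: "j \<le> d"
  shows "a j = 0"
proof -
  let ?V = "\<lambda>j. shifted_prod d j z"
  have nz: "?V j \<noteq> 0" for j using y by (intro shifted_prod_nonzero) simp
  have crosspos: "0 < cross (?V 0) (?V j)" if "0 < j" "j \<le> d" for j
  proof -
    have "prod_arg d 0 z < prod_arg d (Suc 0) z" using prod_arg_increment(1)[OF y d] .
    also have "\<dots> \<le> prod_arg d j z" using that by (intro prod_arg_mono y d) auto
    finally have "0 < prod_arg d j z - prod_arg d 0 z" by simp
    moreover have "prod_arg d j z - prod_arg d 0 z < pi"
      using prod_arg_mono[OF y d that(2)] angle total_angle_eq_prod_arg[OF y, of d] by simp
    ultimately show ?thesis
      unfolding cross_shifted_prod[OF y] using nz by (intro mult_pos_pos sin_gt_zero) auto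
  qed
  have "0 = Im (cnj (?V 0) * (\<Sum>j\<le>d. of_real (a j) * ?V j))" by (simp add: sum)
  also have "\<dots> = (\<Sum>j\<le>d. Im (of_real (a j) * (cnj (?V 0) * ?V j)))"
    by (simp add: sum_distrib_left mult_ac del: times_complex.simps)
  also have "\<dots> = (\<Sum>j\<le>d. a j * cross (?V 0) (?V j))" by (simp add: cross_def)
  finally have s0: "(\<Sum>j\<le>d. a j * cross (?V 0) (?V j)) = 0" by simp
  have "0 \<le> a j * cross (?V 0) (?V j)" if "j \<le> d" for j
    using a[OF that] crosspos[OF _ that] by (cases "j = 0") (auto simp: cross_def)
  then have "\<forall>j\<in>{..d}. a j * cross (?V 0) (?V j) = 0"
    using s0 by (subst (asm) sum_nonneg_eq_0_iff) auto
  then have aj: "a j = 0" if "0 < j" "j \<le> d" for j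
    using crosspos[OF that] that by (metis atMost_iff less_irrefl mult_eq_0_iff)
  have "(\<Sum>j\<le>d. of_real (a j) * ?V j) = of_real (a 0) * ?V 0"
    using aj by (subst sum.remove[of _ 0]) (auto intro!: sum.neutral)
  then have "a 0 = 0" using sum nz[of 0] by simp
  then show ?thesis using aj j by (cases "j = 0") auto
qed

text \<open>Cramer's rule for three vectors in the plane.\<close>

lemma cross_combination:
  "of_real (cross v w) * u + of_real (cross w u) * v + of_real (cross u v) * w = 0"
  by (simp add: complex_eq_iff cross_def algebra_simps)

text \<open>Let \<open>k\<close> be the first index whose product has turned by at least
  \<open>pi\<close>. As each step turns by less than \<open>pi\<close>, zero lies in the cone
  spanned by the products with indices \<open>0\<close>, \<open>k - 1\<close> and
  \<open>k\<close>.\<close>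

lemma root_if_total_angle_ge:
  assumes y: "Im z > 0" and d: "d \<ge> 1" and angle: "pi \<le> total_angle d (z + 1 / 2)"
  shows "\<exists>a :: nat \<Rightarrow> real. (\<forall>j. 0 \<le> a j) \<and> (\<Sum>j\<le>d. a j) > 0
    \<and> (\<Sum>j\<le>d. of_real (a j) * shifted_prod d j z) = 0"
proof -
  let ?V = "\<lambda>j. shifted_prod d j z" and ?A = "\<lambda>j. prod_arg d j z"
  have nz: "?V j \<noteq> 0" for j using y by (intro shifted_prod_nonzero) simp
  define P where "P k \<longleftrightarrow> pi \<le> ?A k - ?A 0" for k
  have Pd: "P d" using angle total_angle_eq_prod_arg[OF y, of d] by (simp add: P_def)
  define k where "k = (LEAST k. P k)"
  have Pk: "P k" unfolding k_def by (rule LeastI[of P, OF Pd])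
  have kd: "k \<le> d" unfolding k_def by (rule Least_le[of P, OF Pd])
  have "\<not> P 0" by (simp add: P_def not_le)
  \<comment> \<open>A single step turns by less than \<open>pi\<close>, so \<open>k \<ge> 2\<close>
    and the indices \<open>0\<close>, \<open>m\<close>, \<open>k\<close> are distinct.\<close>
  moreover have "\<not> P (Suc 0)" using prod_arg_increment(2)[OF y d, of 0] by (simp add: P_def)
  ultimately obtain m where m: "k = Suc m" "m \<ge> 1" using Pk by (metis One_nat_def Suc_le_eq bot_nat_0.not_eq_extremum not0_implies_Suc)
  have "\<not> P m" using not_less_Least[of m P] m by (simp add: k_def)
  then have Am: "?A m - ?A 0 < pi" by (simp add: P_def)
  have Am0: "?A 0 \<le> ?A m" by (intro prod_arg_mono y d) simp
  have inc: "?A m < ?A k" "?A k < ?A m + pi" unfolding m using prod_arg_increment[OF y d] by auto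
  have c1: "0 < cross (?V m) (?V k)"
    unfolding cross_shifted_prod[OF y] using nz inc by (intro mult_pos_pos sin_gt_zero) auto
  have c2: "0 \<le> cross (?V 0) (?V m)"
    unfolding cross_shifted_prod[OF y] using Am Am0 by (intro mult_nonneg_nonneg sin_ge_zero) auto
  \<comment> \<open>The turning up to \<open>k\<close> lies between \<open>pi\<close> and
    \<open>2 * pi\<close>: before the last step it was below \<open>pi\<close>.\<close>
  have "0 \<le> sin (?A k - ?A 0 - pi)"
    using Pk inc Am by (intro sin_ge_zero) (auto simp: P_def)
  also have "\<dots> = sin (?A 0 - ?A k)" by (simp add: sin_diff)
  finally have c3: "0 \<le> cross (?V k) (?V 0)"
    unfolding cross_shifted_prod[OF y] by (intro mult_nonneg_nonneg) auto
  define a where "a j = (if j = 0 then cross (?V m) (?V k) else if j = m then cross (?V k) (?V 0)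
    else if j = k then cross (?V 0) (?V m) else 0)" for j
  have sum3: "(\<Sum>j\<le>d. f j) = f 0 + f m + f k" if "\<And>j. j \<noteq> 0 \<Longrightarrow> j \<noteq> m \<Longrightarrow> j \<noteq> k \<Longrightarrow> f j = 0"
    for f :: "nat \<Rightarrow> complex"
  proof -
    have "(\<Sum>j\<le>d. f j) = (\<Sum>j\<in>{0, m, k}. f j)"
      using that m kd by (intro sum.mono_neutral_right) auto
    then show ?thesis using m by (simp add: add.assoc)
  qed
  have "a 0 \<le> (\<Sum>j\<le>d. a j)"
    using c1 c2 c3 by (intro member_le_sum) (auto simp: a_def)
  moreover have "(\<Sum>j\<le>d. of_real (a j) * ?V j) = of_real (a 0) * ?V 0 + of_real (a m) * ?V m + of_real (a k) * ?V k"
    by (rule sum3) (simp add: a_def)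
  ultimately show ?thesis
    using c1 c2 c3 m cross_combination[of "?V m" "?V k" "?V 0"]
    by (intro exI[where x = a]) (auto simp: a_def)
qed

section \<open>Real points\<close>

text \<open>Two consecutive products share \<open>d - 1\<close> factors; the remaining factors
  \<open>x + d - k\<close> and \<open>x - k\<close> have opposite signs or vanish when
  \<open>k - d \<le> x \<le> k\<close>. Such a pair has a nonnegative combination equal to
  zero.\<close>

lemma real_root_exists:
  assumes d: "d \<ge> 1" and x: "- real d \<le> x" "x \<le> real d - 1"
  shows "\<exists>a :: nat \<Rightarrow> real. (\<forall>j. 0 \<le> a j) \<and> (\<Sum>j\<le>d. a j) > 0
    \<and> (\<Sum>j\<le>d. of_real (a j) * shifted_prod d j (of_real x)) = 0"
proof -
  define v where "v k = (\<Prod>i<d. x + real d - real k - real i)" for k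
  have V: "shifted_prod d k (of_real x) = of_real (v k)" for k
    by (simp add: shifted_prod_def v_def)
  have opp: "v k * v (Suc k) \<le> 0" if "0 \<le> x + real d - real k" "x - real k \<le> 0" for k
  proof -
    obtain n where n: "d = Suc n" using d by (cases d) auto
    let ?M = "\<Prod>i<n. x + real n - real k - real i"
    have "v k = (x + real d - real k) * ?M"
      unfolding v_def n by (subst prod.lessThan_Suc_shift) (simp add: algebra_simps)
    moreover have "v (Suc k) = ?M * (x - real k)"
      by (simp add: v_def n add_diff_eq)
    ultimately have "v k * v (Suc k) = ?M\<^sup>2 * ((x + real d - real k) * (x - real k))"
      by (simp add: power2_eq_square)
    then show ?thesis using that by (simp add: mult_nonneg_nonpos)
  qed
  obtain k where k: "k < d" "v k * v (Suc k) \<le> 0"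
  proof (cases "x \<le> 0")
    case True
    then show ?thesis using opp[of 0] x d that[of 0] by simp
  next
    case False
    \<comment> \<open>From \<open>x \<le> d - 1\<close> it follows that the ceiling is below
      \<open>d\<close>, so index \<open>Suc k\<close> is still admissible.\<close>
    define k where "k = nat \<lceil>x\<rceil>"
    have "real k = of_int \<lceil>x\<rceil>" using False by (simp add: k_def)
    then have "x \<le> real k" "real k < x + 1" by linarith+
    moreover from this x have "real k < real d" by linarith
    moreover have "real d \<ge> 1" using d by simp
    ultimately show ?thesis using opp[of k] that[of k] by (simp add: of_nat_less_iff)
  qed
  \<comment> \<open>Each of the two values is weighted by the modulus of the other. If both vanish,
    weight \<open>1\<close> keeps the sum of the weights positive.\<close>
  define a where "a j = (if v k = 0 \<and> v (Suc k) = 0 then 1 else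
    if j = k then \<bar>v (Suc k)\<bar> else if j = Suc k then \<bar>v k\<bar> else 0)" for j
  define b where "b j = (if j = k \<or> j = Suc k then a j else 0)" for j
  have sum2: "(\<Sum>j\<le>d. f j) = f k + f (Suc k)" if "\<And>j. j \<noteq> k \<Longrightarrow> j \<noteq> Suc k \<Longrightarrow> f j = 0"
    for f :: "nat \<Rightarrow> complex"
  proof -
    have "(\<Sum>j\<le>d. f j) = (\<Sum>j\<in>{k, Suc k}. f j)"
      using that k by (intro sum.mono_neutral_right) auto
    then show ?thesis by simp
  qed
  have b0: "0 \<le> b j" for j by (simp add: b_def a_def)
  then have "b k \<le> (\<Sum>j\<le>d. b j)" "b (Suc k) \<le> (\<Sum>j\<le>d. b j)"
    using k by (auto intro!: member_le_sum)
  moreover have "0 < b k \<or> 0 < b (Suc k)" by (auto simp: b_def a_def)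
  ultimately have "0 < (\<Sum>j\<le>d. b j)" by linarith
  moreover have "(\<Sum>j\<le>d. of_real (b j) * shifted_prod d j (of_real x))
      = of_real (b k * v k + b (Suc k) * v (Suc k))"
    by (subst sum2) (simp_all add: b_def V)
  moreover have "b k * v k + b (Suc k) * v (Suc k) = 0"
    using k(2) by (auto simp: b_def a_def abs_if mult_le_0_iff)
  ultimately show ?thesis
    using b0 by (intro exI[where x = b]) auto
qed

section \<open>From coefficients to polynomials and back\<close>

text \<open>The basis polynomials all have degree \<open>d\<close> and the same positive leading
  coefficient, so a positive coefficient sum rules out cancellation in degree
  \<open>d\<close>.\<close>

lemma nonneg_binomial_poly_exists:
  fixes a :: "nat \<Rightarrow> real"
  assumes a: "\<And>j. 0 \<le> a j" and pos: "(\<Sum>j\<le>d. a j) > 0"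
  shows "\<exists>f. nonneg_binomial_poly d f \<and>
    (\<forall>z. poly f z = (\<Sum>j\<le>d. of_real (a j) * shifted_prod d j z) / fact d)"
proof -
  define B where "B k = (\<Prod>i<d. [: of_nat d - of_nat k - of_nat i, 1 :] :: complex poly)" for k
  define f where "f = Polynomial.smult (1 / fact d) (\<Sum>j\<le>d. Polynomial.smult (of_real (a j)) (B j))"
  have poly_B: "poly (B k) z = shifted_prod d k z" for k z
    by (simp add: B_def poly_prod shifted_prod_def algebra_simps)
  have monic: "degree (\<Prod>i<n. [: c i, 1 :]) = n \<and> lead_coeff (\<Prod>i<n. [: c i, 1 :]) = 1"
    for n and c :: "nat \<Rightarrow> complex"
    by (subst degree_prod_eq_sum_degree) (auto simp: lead_coeff_prod)
  have degB: "degree (B k) = d" "coeff (B k) d = 1" for k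
    using monic[where n = d and c = "\<lambda>i. of_nat d - of_nat k - of_nat i"] by (auto simp: B_def)
  have pf: "poly f z = (\<Sum>j\<le>d. of_real (a j) * shifted_prod d j z) / fact d" for z
    by (simp add: f_def poly_sum poly_B)
  have "coeff f d = of_real (\<Sum>j\<le>d. a j) / fact d"
    by (simp add: f_def coeff_sum degB)
  then have "coeff f d \<noteq> 0" using pos by (simp del: of_real_sum)
  moreover have "degree f \<le> d"
    unfolding f_def by (intro order_trans[OF degree_smult_le] degree_sum_le) (auto simp: degB)
  ultimately have "degree f = d" by (intro antisym le_degree)
  then have "nonneg_binomial_poly d f"
    unfolding nonneg_binomial_poly_def using a
    by (intro conjI exI[where x = a])
       (auto simp: pf gchoose_shifted_prod sum_divide_distrib atLeast0AtMost)
  then show ?thesis using pf by blast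
qed

lemma nonneg_binomial_polyE:
  assumes f: "nonneg_binomial_poly d f" and d: "d \<ge> 1"
  obtains a :: "nat \<Rightarrow> real" and j where "\<And>j. j \<le> d \<Longrightarrow> 0 \<le> a j" "j \<le> d" "0 < a j"
    "\<And>z. poly f z = (\<Sum>j\<le>d. of_real (a j) * shifted_prod d j z) / fact d"
proof -
  obtain a :: "nat \<Rightarrow> real" where a: "\<And>j. j \<le> d \<Longrightarrow> 0 \<le> a j"
    and p: "\<And>z. poly f z = (\<Sum>j\<le>d. of_real (a j) * shifted_prod d j z) / fact d"
    using f by (auto simp: nonneg_binomial_poly_def gchoose_shifted_prod sum_divide_distrib atLeast0AtMost)
  have "\<exists>j\<le>d. 0 < a j"
  proof (rule ccontr)
    assume "\<not> ?thesis"
    then have "a j = 0" if "j \<le> d" for j using a[OF that] that by force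
    then have "poly f z = 0" for z by (simp add: p)
    then have "f = 0" using poly_all_0_iff_0 by blast
    then show False using f d by (simp add: nonneg_binomial_poly_def)
  qed
  then show ?thesis using a p that by blast
qed

text \<open>Outside the interval all factors of all products have one sign, so the values
  \<open>v k\<close> share the sign \<open>e\<close> and cannot cancel.\<close>

lemma nonneg_binomial_poly_real_roots:
  assumes f: "nonneg_binomial_poly d f" and d: "d \<ge> 1" and root: "poly f (complex_of_real x) = 0"
  shows "x \<in> {- real d .. real d - 1}"
proof (rule ccontr)
  assume x: "x \<notin> {- real d .. real d - 1}"
  obtain a j where a: "\<And>j. j \<le> d \<Longrightarrow> 0 \<le> a j" and j: "j \<le> d" "0 < a j"
    and p: "\<And>z. poly f z = (\<Sum>j\<le>d. of_real (a j) * shifted_prod d j z) / fact d"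
    using nonneg_binomial_polyE[OF f d] by metis
  define v where "v k = (\<Prod>i<d. x + real d - real k - real i)" for k
  have V: "shifted_prod d k (of_real x) = of_real (v k)" for k
    by (simp add: shifted_prod_def v_def)
  obtain e :: real where e: "\<And>k. k \<le> d \<Longrightarrow> 0 < e * v k"
  proof (cases "x > real d - 1")
    case True
    have "0 < 1 * v k" if "k \<le> d" for k
      unfolding v_def mult_1 using True that by (intro prod_pos) auto
    then show ?thesis using that by blast
  next
    case False
    then have "x < - real d" using x by auto
    have "(-1) ^ d * v k = (\<Prod>i<d. - (x + real d - real k - real i))" for k
      unfolding v_def by (simp only: prod_uminus card_lessThan)
    moreover have "0 < (\<Prod>i<d. - (x + real d - real k - real i))" for k
      using \<open>x < - real d\<close> by (intro prod_pos) auto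
    ultimately show ?thesis using that[of "(-1) ^ d"] by simp
  qed
  have "(\<Sum>j\<le>d. of_real (a j) * shifted_prod d j (of_real x)) = complex_of_real (\<Sum>j\<le>d. a j * v j)"
    by (simp add: V)
  then have "(\<Sum>j\<le>d. a j * v j) = 0" using root p[of "of_real x"] by (simp del: of_real_sum)
  then have "(\<Sum>j\<le>d. a j * (e * v j)) = 0"
    by (simp add: mult.left_commute[of _ e] flip: sum_distrib_left)
  moreover have "(\<Sum>j\<le>d. a j * (e * v j)) > 0"
    using a j e by (intro sum_pos2[of _ j]) (auto intro!: mult_nonneg_nonneg simp: less_imp_le)
  ultimately show False by simp
qed

section \<open>Roots and the closed region\<close>

lemma total_angle_cnj_shift: "total_angle d (cnj z + 1 / 2) = total_angle d (z + 1 / 2)"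
  using total_angle_cnj[of d "z + 1 / 2"] by simp

lemma sum_shifted_prod_cnj:
  "(\<Sum>j\<le>d. of_real (a j) * shifted_prod d j (cnj z)) = cnj (\<Sum>j\<le>d. of_real (a j) * shifted_prod d j z)"
  by (simp add: shifted_prod_cnj)

lemma total_angle_ge_pi_of_root:
  assumes f: "nonneg_binomial_poly d f" and d: "d \<ge> 1" and root: "poly f z = 0" and y: "Im z \<noteq> 0"
  shows "pi \<le> total_angle d (z + 1 / 2)"
proof (rule ccontr)
  assume less: "\<not> ?thesis"
  obtain a j where a: "\<And>j. j \<le> d \<Longrightarrow> 0 \<le> a j" and j: "j \<le> d" "0 < a j"
    and p: "\<And>z. poly f z = (\<Sum>j\<le>d. of_real (a j) * shifted_prod d j z) / fact d"
    using nonneg_binomial_polyE[OF f d] by metis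
  have sum: "(\<Sum>j\<le>d. of_real (a j) * shifted_prod d j z) = 0" using root p[of z] by simp
  show False
  proof (cases "Im z > 0")
    case True
    then show ?thesis using no_root_if_total_angle_less[OF True d _ a sum j(1)] less j(2) by simp
  next
    case False
    then have "Im (cnj z) > 0" using y by simp
    moreover have "(\<Sum>j\<le>d. of_real (a j) * shifted_prod d j (cnj z)) = 0"
      unfolding sum_shifted_prod_cnj sum by simp
    ultimately show ?thesis
      using no_root_if_total_angle_less[of "cnj z" d a j] a d j less by (simp add: total_angle_cnj_shift)
  qed
qed

text \<open>If the ray through \<open>z\<close> meets \<open>outer_curve d\<close> at the factor
  \<open>s\<close>, then both sides amount to \<open>s \<ge> 1\<close>.\<close>

lemma nonreal_in_cl_region_iff:
  assumes d: "d \<ge> 2" and y: "Im z \<noteq> 0"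
  shows "z \<in> cl_region d \<longleftrightarrow> pi \<le> total_angle d (z + 1 / 2)"
proof -
  define w where "w = z + 1 / 2"
  have w: "Im w \<noteq> 0" "w \<noteq> 0" using y by (auto simp: w_def complex_eq_iff)
  have z: "- 1 / 2 + 1 *\<^sub>R w = z" by (simp add: w_def)
  obtain s where s: "0 < s" "- 1 / 2 + s *\<^sub>R w \<in> outer_curve d"
    and uniq: "\<And>t. 0 < t \<Longrightarrow> - 1 / 2 + t *\<^sub>R w \<in> outer_curve d \<Longrightarrow> t = s"
    using outer_curve_ray[OF d w(2)] by blast
  have angle: "total_angle d (s *\<^sub>R w) = pi" using s by (simp add: outer_curve_def)
  have "z \<in> outer_curve d \<longleftrightarrow> s = 1"
  proof
    assume "z \<in> outer_curve d"
    then show "s = 1" using uniq[of 1, unfolded z] by simp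
  next
    assume "s = 1"
    then show "z \<in> outer_curve d" using s(2) by (simp only: z)
  qed
  moreover have "z \<in> inside (outer_curve d) \<longleftrightarrow> s > 1"
  proof
    assume "z \<in> inside (outer_curve d)"
    then obtain t where "t > 1" "- 1 / 2 + t *\<^sub>R w \<in> outer_curve d"
      using y by (auto simp: inside_outer_curve[OF d] w_def)
    then show "s > 1" using uniq[of t] by simp
  next
    assume "s > 1"
    then show "z \<in> inside (outer_curve d)" using s(2) by (auto simp: inside_outer_curve[OF d] w_def)
  qed
  ultimately have "z \<in> cl_region d \<longleftrightarrow> s \<ge> 1" by (auto simp: cl_region_def outermost_oval_eq[OF d])
  moreover have "pi \<le> total_angle d (1 *\<^sub>R w)" if "s \<ge> 1"
    using total_angle_ray_le[of 1 s d w] that angle by simp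
  moreover have "total_angle d (1 *\<^sub>R w) < pi" if "s < 1"
    using total_angle_ray_less[OF w(1) s(1) that, of d] d angle by simp
  ultimately show ?thesis by (auto simp: w_def not_le[symmetric])
qed

text \<open>On the real axis the outer curve stays within the longest segment, whose half-length is
  \<open>d - 1 / 2\<close>; the shift by \<open>1 / 2\<close> turns this into the asymmetric
  bounds.\<close>

lemma real_in_cl_region:
  assumes d: "d \<ge> 2" and z: "of_real x \<in> cl_region d"
  shows "- real d \<le> x" "x \<le> real d - 1"
proof -
  obtain n where n: "d = Suc (Suc n)" using le_Suc_ex[OF d] by auto
  have "\<bar>x + 1 / 2\<bar> < half_odd (Suc n)"
  proof (cases "of_real x = (- 1 / 2 :: complex)")
    case True
    then have "x = - 1 / 2" by (simp add: complex_eq_iff)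
    then show ?thesis by simp
  next
    case False
    then consider "of_real x \<in> outer_curve d"
      | t where "t > 1" "- 1 / 2 + t *\<^sub>R (of_real x + 1 / 2) \<in> outer_curve d"
      using z by (auto simp: cl_region_def outermost_oval_eq[OF d] inside_outer_curve[OF d])
    then obtain t where t: "t \<ge> 1" "- 1 / 2 + t *\<^sub>R (of_real x + 1 / 2) \<in> outer_curve d"
    proof cases
      case 1
      then show ?thesis using that[of 1] by simp
    next
      case (2 t)
      then show ?thesis using that[of t] by simp
    qed
    then have "norm (t *\<^sub>R (of_real x + 1 / 2 :: complex)) < half_odd (Suc n)"
      using outer_curve_real[of "- 1 / 2 + t *\<^sub>R (of_real x + 1 / 2)" n] by (simp add: n del: oval_im.simps)
    moreover have "norm (of_real x + 1 / 2 :: complex) = \<bar>x + 1 / 2\<bar>"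
    proof -
      have "of_real x + 1 / 2 = complex_of_real (x + 1 / 2)" by simp
      then show ?thesis by (simp only: norm_of_real)
    qed
    ultimately have "t * \<bar>x + 1 / 2\<bar> < half_odd (Suc n)" using t(1) by simp
    moreover have "1 * \<bar>x + 1 / 2\<bar> \<le> t * \<bar>x + 1 / 2\<bar>" using t(1) by (intro mult_right_mono) auto
    ultimately show ?thesis by simp
  qed
  then show "- real d \<le> x" "x \<le> real d - 1" by (simp_all add: n half_odd_def)
qed

lemma nonneg_combination_if_in_cl_region:
  assumes d: "d \<ge> 2" and z: "z \<in> cl_region d"
  shows "\<exists>a :: nat \<Rightarrow> real. (\<forall>j. 0 \<le> a j) \<and> (\<Sum>j\<le>d. a j) > 0
    \<and> (\<Sum>j\<le>d. of_real (a j) * shifted_prod d j z) = 0"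
proof -
  have d1: "d \<ge> 1" using d by simp
  consider "Im z = 0" | "Im z > 0" | "Im z < 0" by linarith
  then show ?thesis
  proof cases
    case 1
    then have "z = of_real (Re z)" by (simp add: complex_eq_iff)
    then show ?thesis using real_in_cl_region[OF d, of "Re z"] real_root_exists[OF d1, of "Re z"] z by metis
  next
    case 2
    then show ?thesis using root_if_total_angle_ge[OF 2 d1] nonreal_in_cl_region_iff[OF d, of z] z by simp
  next
    case 3
    then have "pi \<le> total_angle d (cnj z + 1 / 2)"
      using nonreal_in_cl_region_iff[OF d, of z] z unfolding total_angle_cnj_shift by simp
    then obtain a where a: "\<forall>j. 0 \<le> a j" "(\<Sum>j\<le>d. a j) > 0"
      "(\<Sum>j\<le>d. of_real (a j) * shifted_prod d j (cnj z)) = 0"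
      using root_if_total_angle_ge[of "cnj z" d] 3 d1 by auto
    then have "(\<Sum>j\<le>d. of_real (a j) * shifted_prod d j z) = 0"
      using sum_shifted_prod_cnj[of a d z] by (metis complex_cnj_zero_iff)
    then show ?thesis using a by blast
  qed
qed

theorem theorem4p11:
  fixes d :: nat
  assumes "d \<ge> 2"
  shows "(\<forall>f. nonneg_binomial_poly d f \<longrightarrow>
            (\<forall>z. poly f z = 0 \<and> z \<notin> \<real> \<longrightarrow> z \<in> cl_region d))
       \<and> curve d = {z. D0 d (Re z) (Im z) = 0}
       \<and> (\<forall>z\<in>cl_region d. \<exists>f. nonneg_binomial_poly d f \<and> poly f z = 0)
       \<and> (\<forall>f. nonneg_binomial_poly d f \<longrightarrow>
            (\<forall>x :: real. poly f (complex_of_real x) = 0 \<longrightarrow> x \<in> {- real d .. real d - 1}))"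
proof (intro conjI allI impI ballI)
  have d: "d \<ge> 1" using assms by simp
  show "z \<in> cl_region d" if "nonneg_binomial_poly d f" "poly f z = 0 \<and> z \<notin> \<real>" for f z
    using that total_angle_ge_pi_of_root[OF that(1) d, of z] nonreal_in_cl_region_iff[OF assms, of z]
    by (simp add: complex_is_Real_iff)
  show "curve d = {z. D0 d (Re z) (Im z) = 0}"
    by (rule curve_eq_D0[OF d])
  show "\<exists>f. nonneg_binomial_poly d f \<and> poly f z = 0" if z: "z \<in> cl_region d" for z
  proof -
    obtain a :: "nat \<Rightarrow> real" where "\<And>j. 0 \<le> a j" "(\<Sum>j\<le>d. a j) > 0"
      "(\<Sum>j\<le>d. of_real (a j) * shifted_prod d j z) = 0"
      using nonneg_combination_if_in_cl_region[OF assms z] by blast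
    then show ?thesis using nonneg_binomial_poly_exists[of a d] by auto
  qed
  show "x \<in> {- real d .. real d - 1}"
    if "nonneg_binomial_poly d f" "poly f (complex_of_real x) = 0" for f x
    using nonneg_binomial_poly_real_roots[OF that(1) d that(2)] .
qed

end
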